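(* Let $\gamma>0$ and let $h:[0,\infty)\to\mathbb{R}$ be a $C^1$ function with $h(0)=0$ such that for all $y>0$: (1) $|h(y)|<y/\gamma$; (2) $h(y)\,(2\gamma-(1+\gamma^2)h'(y))<y$; (3) $h(y)\,(2\gamma+(1+\gamma^2)h'(y))>-y$. Consider the planar piecewise linear system with two zones, for $X=(x,y)\in\mathbb{R}^2$, $$X'=\begin{cases}G^-X & \text{if } H(X)<0,\\ G^+X & \text{if } H(X)\ge 0,\end{cases}\qquad G^{\pm}=\begin{pmatrix}\pm 2\gamma&-1\\ \gamma^2+1&0\end{pmatrix},\qquad H(x,y)=\begin{cases}x & \text{if } y\le 0,\\ x-h(y) & \text{if } y>0.\end{cases}$$ Let $y^*>0$. Then there exists a periodic solution of this system passing through the point $(h(y^* ),y^* )$ if and only if $h(y^* )=0$. In this case the periodic solution cuts the $y$-axis at the points $(0,y^* )$ and $(0,-e^{-\gamma\pi}y^* )$. Moreover, in this case, if $h'(y^* )>0$ then this periodic solution is a stable limit cycle, and if $h'(y^* )<0$ then it is an unstable limit cycle.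
   Context: Solutions are understood by concatenation: a solution is a continuous curve that follows the linear flow of $G^-$ in $\{H<0\}$ and that of $G^+$ in $\{H>0\}$, passing from one zone to the other across $\{H=0\}$ (both fields cross the switching curve in the same direction under hypotheses (2) and (3), so there is no sliding). A periodic solution means a nonconstant one. A limit cycle is an isolated periodic orbit. It is stable if all orbits starting near it, on both sides, converge to it as $t\to+\infty$, and unstable if all orbits starting near it, on both sides, converge to it as $t\to-\infty$. *)

theory Defs
  imports "HOL-Analysis.Analysis"
begin

definition G_minus :: "real \<Rightarrow> real^2^2" where
  "G_minus \<gamma> = vector [vector [- 2 * \<gamma>, -1], vector [\<gamma>\<^sup>2 + 1, 0]]"

definition G_plus :: "real \<Rightarrow> real^2^2" where
  "G_plus \<gamma> = vector [vector [2 * \<gamma>, -1], vector [\<gamma>\<^sup>2 + 1, 0]]"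

definition switch_fun :: "(real \<Rightarrow> real) \<Rightarrow> real^2 \<Rightarrow> real" where
  "switch_fun h p = (if p $ 2 \<le> 0 then p $ 1 else p $ 1 - h (p $ 2))"

definition pw_field :: "real \<Rightarrow> (real \<Rightarrow> real) \<Rightarrow> real^2 \<Rightarrow> real^2" where
  "pw_field \<gamma> h p = (if switch_fun h p < 0 then G_minus \<gamma> *v p else G_plus \<gamma> *v p)"

definition crosses_at :: "(real \<Rightarrow> real) \<Rightarrow> (real \<Rightarrow> real^2) \<Rightarrow> real \<Rightarrow> bool" where
  "crosses_at h X t \<longleftrightarrow>
     (\<forall>\<^sub>F s in at_left t. switch_fun h (X s) < 0) \<and>
     (\<forall>\<^sub>F s in at_right t. switch_fun h (X s) > 0)
   \<or> (\<forall>\<^sub>F s in at_left t. switch_fun h (X s) > 0) \<and>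
     (\<forall>\<^sub>F s in at_right t. switch_fun h (X s) < 0)"

text \<open>
  Solutions on a time interval \<open>I\<close> by concatenation: continuous curves that follow the linear
  flow of the respective zone off the switching curve and that pass from one zone to the
  other whenever they meet it. The only point of the switching curve that is exempt from
  crossing is the origin, which is an equilibrium of both linear fields. At a crossing no
  derivative is required, since the two fields may disagree there.
\<close>

definition solution_on :: "real \<Rightarrow> (real \<Rightarrow> real) \<Rightarrow> real set \<Rightarrow> (real \<Rightarrow> real^2) \<Rightarrow> bool" where
  "solution_on \<gamma> h I X \<longleftrightarrow>
     continuous_on I X \<and>
     (\<forall>t \<in> interior I.
        if switch_fun h (X t) = 0 \<and> X t \<noteq> 0 then crosses_at h X t
        else (X has_vector_derivative pw_field \<gamma> h (X t)) (at t))"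

definition periodic_solution :: "real \<Rightarrow> (real \<Rightarrow> real) \<Rightarrow> (real \<Rightarrow> real^2) \<Rightarrow> bool" where
  "periodic_solution \<gamma> h X \<longleftrightarrow>
     solution_on \<gamma> h UNIV X \<and> \<not> X constant_on UNIV \<and> (\<exists>T>0. \<forall>t. X (t + T) = X t)"

definition periodic_orbit :: "real \<Rightarrow> (real \<Rightarrow> real) \<Rightarrow> (real^2) set \<Rightarrow> bool" where
  "periodic_orbit \<gamma> h \<Gamma> \<longleftrightarrow> (\<exists>X. periodic_solution \<gamma> h X \<and> \<Gamma> = range X)"

definition limit_cycle :: "real \<Rightarrow> (real \<Rightarrow> real) \<Rightarrow> (real^2) set \<Rightarrow> bool" where
  "limit_cycle \<gamma> h \<Gamma> \<longleftrightarrow>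
     periodic_orbit \<gamma> h \<Gamma> \<and>
     (\<exists>\<epsilon>>0. \<forall>\<Gamma>'. periodic_orbit \<gamma> h \<Gamma>' \<and> (\<exists>p\<in>\<Gamma>'. infdist p \<Gamma> < \<epsilon>) \<longrightarrow> \<Gamma>' = \<Gamma>)"

text \<open>
  Starting points range over a full neighbourhood of the orbit, hence over both sides of it;
  convergence to the orbit means that the distance to it tends to 0.
\<close>

definition stable_limit_cycle :: "real \<Rightarrow> (real \<Rightarrow> real) \<Rightarrow> (real^2) set \<Rightarrow> bool" where
  "stable_limit_cycle \<gamma> h \<Gamma> \<longleftrightarrow>
     limit_cycle \<gamma> h \<Gamma> \<and>
     (\<exists>\<epsilon>>0. \<forall>X. solution_on \<gamma> h {0..} X \<and> infdist (X 0) \<Gamma> < \<epsilon> \<longrightarrow>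
        ((\<lambda>t. infdist (X t) \<Gamma>) \<longlongrightarrow> 0) at_top)"

definition unstable_limit_cycle :: "real \<Rightarrow> (real \<Rightarrow> real) \<Rightarrow> (real^2) set \<Rightarrow> bool" where
  "unstable_limit_cycle \<gamma> h \<Gamma> \<longleftrightarrow>
     limit_cycle \<gamma> h \<Gamma> \<and>
     (\<exists>\<epsilon>>0. \<forall>X. solution_on \<gamma> h {..0} X \<and> infdist (X 0) \<Gamma> < \<epsilon> \<longrightarrow>
        ((\<lambda>t. infdist (X t) \<Gamma>) \<longlongrightarrow> 0) at_bot)"

end

(* In the coordinate Z = y + i (k y - (1 + \<gamma>^2) x), with k = \<gamma> on the right and k = -\<gamma> on the left, each
   linear flow is Z' = (k + i) Z: it turns with unit angular speed along the level curves of
   ln |Z| - k arg Z, which is called the level. The levels on the two sides agree on the negative y-axis.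
   Along the switching curve the left level A y and the right level B y of (h y, y) are strictly
   increasing in y: this is what conditions (2) and (3) say. Hence the return map on the curve is
   B^(-1) o A, and B - A has the sign of h, so it moves y down where h > 0, up where h < 0, and fixes y
   exactly where h y = 0. Monotonicity of the return map excludes other periodic orbits and gives
   convergence when h' > 0 at a zero of h. The case h' < 0 follows by reversing time and reflecting x. *)

theory Submission imports Defs begin

text \<open>The definition of a solution supplies neither uniqueness nor a derivative at a crossing,
  so no flow is available in advance. Instead every solution is shown to run along explicit spirals:
  the crossing condition decides which zone is entered just after a given time, the linear equation
  is integrated there, and the sign of \<open>H\<close> along a spiral tells how long it stays. This
  determines the forward motion from every nonzero point. Backward motion is not analysed directly:
  the hypotheses form a locale so that they can be interpreted a second time for \<open>- h\<close>,
  which exchanges (2) and (3).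

  The sign of \<open>B - A\<close> has a simple source. The difference depends only on the slope
  \<open>u = m * h y / y\<close>, vanishes at \<open>u = 0\<close>, and has derivative
  \<open>4 * \<gamma> * u\<^sup>2\<close> over a positive product, so it increases through 0. A
  solution leaving a point of the curve with \<open>h y \<noteq> 0\<close> cannot come back to it,
  because the levels of the later turns stay on the wrong side of \<open>B y\<close>.\<close>

locale two_zone =
  fixes \<gamma> :: real and h h' :: "real \<Rightarrow> real"
  assumes gpos: "\<gamma> > 0"
    and h_deriv: "\<And>y. y \<ge> 0 \<Longrightarrow> (h has_real_derivative h' y) (at y within {0..})"
    and h0: "h 0 = 0"
    and cross_plus: "\<And>y. y > 0 \<Longrightarrow> h y * (2 * \<gamma> - (1 + \<gamma>\<^sup>2) * h' y) < y"
    and cross_minus: "\<And>y. y > 0 \<Longrightarrow> h y * (2 * \<gamma> + (1 + \<gamma>\<^sup>2) * h' y) > - y"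
begin

abbreviation "m \<equiv> \<gamma>\<^sup>2 + 1"
definition \<alpha> :: real where "\<alpha> = arctan \<gamma>"
abbreviation "H \<equiv> switch_fun h"

text \<open>A zone is named by the sign of its trace: \<open>k = \<gamma>\<close> on the right, \<open>k = - \<gamma>\<close> on the left,
  so that the zone \<open>k\<close> is where \<open>k * H p > 0\<close>.\<close>

definition is_zone :: "real \<Rightarrow> bool" where "is_zone k \<longleftrightarrow> k = \<gamma> \<or> k = - \<gamma>"

text \<open>Each matrix has eigenvalues \<open>k + i\<close> and \<open>k - i\<close>; this
  functional is a left eigenvector for \<open>k + i\<close>.\<close>

definition Zc :: "real \<Rightarrow> real^2 \<Rightarrow> complex" where
  "Zc k p = Complex (p $ 2) (k * p $ 2 - m * p $ 1)"

text \<open>The spiral point of level \<open>v\<close> and angle \<open>\<theta>\<close>: its coordinate \<open>Zc k\<close> has modulus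
  \<open>exp (v + k * \<theta>)\<close> and argument \<open>\<theta>\<close>.\<close>

definition sp :: "real \<Rightarrow> real \<Rightarrow> real \<Rightarrow> real^2" where
  "sp k v \<theta> = vector [exp (v + k * \<theta>) * (k * cos \<theta> - sin \<theta>) / m, exp (v + k * \<theta>) * cos \<theta>]"

text \<open>The principal branch suffices: its cut is the ray where \<open>Zc k\<close> is a
  negative real, and there \<open>k * H\<close> is negative, so the closed zone \<open>k\<close>
  without the origin avoids the cut.\<close>

definition ang :: "real \<Rightarrow> real^2 \<Rightarrow> real" where "ang k p = Im (Ln (Zc k p))"

definition lev :: "real \<Rightarrow> real^2 \<Rightarrow> real" where
  "lev k p = Re (Ln (Zc k p)) - k * ang k p"

definition cp :: "real \<Rightarrow> real^2" where "cp y = vector [h y, y]"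

section \<open>Spiral coordinates\<close>

lemma m_pos: "m > 0"
  by (simp add: add_nonneg_pos)

lemma m_nz [simp]: "m \<noteq> 0"
  using m_pos by simp

lemma is_zone_sq: "is_zone k \<Longrightarrow> k\<^sup>2 = \<gamma>\<^sup>2"
  by (auto simp: is_zone_def)

lemma is_zone_nz: "is_zone k \<Longrightarrow> k \<noteq> 0"
  using gpos by (auto simp: is_zone_def)

lemma is_zone_minus [simp]: "is_zone (- k) \<longleftrightarrow> is_zone k"
  by (auto simp: is_zone_def)

lemma is_zone_gamma [simp]: "is_zone \<gamma>"
  by (auto simp: is_zone_def)

lemma alpha_bounds: "0 < \<alpha>" "\<alpha> < pi / 2"
  using gpos arctan_bounded[of \<gamma>] by (auto simp: \<alpha>_def)

lemma cos_alpha_pos: "cos \<alpha> > 0"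
  using alpha_bounds by (intro cos_gt_zero_pi) auto

lemma sin_alpha: "sin \<alpha> = \<gamma> * cos \<alpha>"
  using tan_arctan[of \<gamma>] cos_alpha_pos by (simp add: \<alpha>_def tan_def field_simps del: tan_arctan)

lemma sp_nth [simp]:
  "sp k v \<theta> $ 1 = exp (v + k * \<theta>) * (k * cos \<theta> - sin \<theta>) / m"
  "sp k v \<theta> $ 2 = exp (v + k * \<theta>) * cos \<theta>"
  by (simp_all add: sp_def)

lemma cp_nth [simp]: "cp y $ 1 = h y" "cp y $ 2 = y"
  by (simp_all add: cp_def)

lemma vec2_eq_iff: "(p :: real^2) = q \<longleftrightarrow> p $ 1 = q $ 1 \<and> p $ 2 = q $ 2"
  by (simp add: vec_eq_iff forall_2)

lemma Zc_inj: "Zc k p = Zc k q \<Longrightarrow> p = q"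
  by (auto simp: Zc_def vec2_eq_iff)

lemma Zc_0_iff: "Zc k p = 0 \<longleftrightarrow> p = 0"
  by (auto simp: Zc_def vec2_eq_iff complex_eq_iff)

lemma Zc_sp: "Zc k (sp k v \<theta>) = exp (Complex (v + k * \<theta>) \<theta>)"
proof -
  have "m * (sp k v \<theta> $ 1) = exp (v + k * \<theta>) * (k * cos \<theta> - sin \<theta>)" by simp
  then show ?thesis
    unfolding Zc_def by (simp add: complex_eq_iff Re_exp Im_exp right_diff_distrib del: sp_nth(1))
qed

lemma sp_nonzero [simp]: "sp k v \<theta> \<noteq> 0"
  using Zc_0_iff[of k "sp k v \<theta>"] by (simp add: Zc_sp)

lemma ang_bounds: "p \<noteq> 0 \<Longrightarrow> - pi < ang k p \<and> ang k p \<le> pi"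
  unfolding ang_def by (simp add: Zc_0_iff mpi_less_Im_Ln Im_Ln_le_pi)

lemma sp_lev_ang: "p \<noteq> 0 \<Longrightarrow> sp k (lev k p) (ang k p) = p"
proof (rule Zc_inj)
  assume "p \<noteq> 0"
  then have "exp (Ln (Zc k p)) = Zc k p" by (simp add: Zc_0_iff)
  moreover have "Complex (lev k p + k * ang k p) (ang k p) = Ln (Zc k p)"
    by (simp add: lev_def ang_def complex_eq_iff)
  ultimately show "Zc k (sp k (lev k p) (ang k p)) = Zc k p" by (simp add: Zc_sp)
qed

lemma lev_ang_sp:
  assumes "- pi < \<theta>" "\<theta> \<le> pi"
  shows "lev k (sp k v \<theta>) = v" "ang k (sp k v \<theta>) = \<theta>"
proof -
  have "Ln (Zc k (sp k v \<theta>)) = Complex (v + k * \<theta>) \<theta>"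
    unfolding Zc_sp using assms by (intro Ln_exp) auto
  then show "lev k (sp k v \<theta>) = v" "ang k (sp k v \<theta>) = \<theta>"
    by (auto simp: lev_def ang_def)
qed

lemma cp_nonzero: "y > 0 \<Longrightarrow> cp y \<noteq> 0"
  by (auto simp: vec2_eq_iff)

section \<open>Levels along the switching curve\<close>

lemma ang_upper:
  assumes "p $ 2 > 0"
  shows "ang k p = arctan (k - m * p $ 1 / p $ 2)"
proof -
  have "ang k p = arctan ((k * p $ 2 - m * p $ 1) / p $ 2)"
    unfolding ang_def using assms by (simp add: Zc_def Im_Ln_eq complex_eq_iff)
  moreover have "(k * p $ 2 - m * p $ 1) / p $ 2 = k - m * p $ 1 / p $ 2"
    using assms by (simp add: field_simps)
  ultimately show ?thesis by simp
qed

text \<open>The level of \<open>(x, y)\<close> with \<open>y > 0\<close> is \<open>ln y\<close> plus a function of the slope \<open>u = m * x / y\<close>.\<close>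

definition slope_lev :: "real \<Rightarrow> real \<Rightarrow> real" where
  "slope_lev k u = ln (1 + (k - u)\<^sup>2) / 2 - k * arctan (k - u)"

lemma one_plus_square_pos: "1 + (x :: real)\<^sup>2 > 0"
  by (simp add: add_pos_nonneg)

text \<open>The logarithm contributes \<open>u - k\<close> and the arctangent contributes
  \<open>k\<close> over the same denominator, so the numerator is \<open>u\<close> for either
  zone.\<close>

lemma slope_lev_deriv: "(slope_lev k has_real_derivative u / (1 + (k - u)\<^sup>2)) (at u)"
proof -
  have d1: "((\<lambda>u. 1 + (k - u)\<^sup>2) has_real_derivative - (2 * (k - u))) (at u)"
    by (auto intro!: derivative_eq_intros)
  have d2: "((\<lambda>u. arctan (k - u)) has_real_derivative - inverse (1 + (k - u)\<^sup>2)) (at u)"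
    by (rule DERIV_cong[OF DERIV_chain2[OF DERIV_arctan]]) (auto intro!: derivative_eq_intros)
  have d3: "((\<lambda>u. ln (1 + (k - u)\<^sup>2)) has_real_derivative inverse (1 + (k - u)\<^sup>2) * - (2 * (k - u))) (at u)"
    by (rule DERIV_chain2[OF DERIV_ln d1]) (rule one_plus_square_pos)
  have "(slope_lev k has_real_derivative
      inverse (1 + (k - u)\<^sup>2) * - (2 * (k - u)) / 2 - k * - inverse (1 + (k - u)\<^sup>2)) (at u)"
    unfolding slope_lev_def by (intro DERIV_diff DERIV_cdivide DERIV_cmult d2 d3)
  moreover have "inverse q * - (2 * (k - u)) / 2 - k * - inverse q = u / q" for q :: real
    by (cases "q = 0") (auto simp: field_simps)
  ultimately show ?thesis by metis
qed

text \<open>This is \<open>B - A\<close> as a function of the slope alone: the term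
  \<open>ln y\<close> is common to both levels and cancels.\<close>

definition jump :: "real \<Rightarrow> real" where
  "jump u = slope_lev \<gamma> u - slope_lev (- \<gamma>) u"

lemma lev_upper:
  assumes "p $ 2 > 0"
  shows "lev k p = ln (p $ 2) + slope_lev k (m * p $ 1 / p $ 2)"
proof -
  have nz: "Zc k p \<noteq> 0" using assms by (auto simp: Zc_def complex_eq_iff)
  have "(p $ 2)\<^sup>2 + (k * p $ 2 - m * p $ 1)\<^sup>2 = (p $ 2)\<^sup>2 * (1 + (k - m * p $ 1 / p $ 2)\<^sup>2)"
    using assms by (simp add: field_simps power2_eq_square)
  then have "cmod (Zc k p) = p $ 2 * sqrt (1 + (k - m * p $ 1 / p $ 2)\<^sup>2)"
    using assms by (simp add: Zc_def cmod_def real_sqrt_mult)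
  moreover have "1 + (k - m * p $ 1 / p $ 2)\<^sup>2 > 0" by (simp add: add_pos_nonneg)
  ultimately have "Re (Ln (Zc k p)) = ln (p $ 2) + ln (1 + (k - m * p $ 1 / p $ 2)\<^sup>2) / 2"
    using assms nz by (simp add: ln_mult ln_sqrt)
  then show ?thesis by (simp add: lev_def ang_upper[OF assms] slope_lev_def)
qed

text \<open>The derivative of the level is a positive multiple of
  \<open>y - 2 * k * h y + m * h y * h' y\<close>. Its positivity is \<open>cross_plus\<close> for
  \<open>k = \<gamma>\<close> and \<open>cross_minus\<close> for \<open>k = - \<gamma>\<close>. The
  same quantity is minus the rate of change of \<open>x - h y\<close> along the field of zone
  \<open>k\<close>, so monotonicity of the level expresses transversality.\<close>

lemma lev_cp_strict_mono:
  assumes k: "is_zone k" and "0 < y1" "y1 < y2"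
  shows "lev k (cp y1) < lev k (cp y2)"
proof -
  define F where "F y = ln y + slope_lev k (m * h y / y)" for y
  have F: "lev k (cp y) = F y" if "y > 0" for y
    using that by (simp add: lev_upper F_def)
  have "F y1 < F y2"
  proof (rule DERIV_pos_imp_increasing[OF \<open>y1 < y2\<close>], intro allI impI exI conjI)
    fix y assume y: "y1 \<le> y" "y \<le> y2"
    then have yp: "y > 0" using assms by simp
    have hd: "(h has_real_derivative h' y) (at y)"
      using h_deriv[of y] yp at_within_interior[of y "{0..}"] by (simp add: interior_real_atLeast)
    let ?u = "m * h y / y"
    let ?q = "1 + (k - ?u)\<^sup>2"
    have q: "?q > 0" by (simp add: add_pos_nonneg)
    have "((\<lambda>y. m * h y / y) has_real_derivative (m * h' y * y - m * h y * 1) / (y * y)) (at y)"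
      using yp by (intro DERIV_divide DERIV_cmult hd DERIV_ident) simp
    then have "((\<lambda>y. slope_lev k (m * h y / y)) has_real_derivative
        ?u / ?q * ((m * h' y * y - m * h y * 1) / (y * y))) (at y)"
      by (rule DERIV_chain2[OF slope_lev_deriv])
    moreover have "(m * h' y * y - m * h y * 1) / (y * y) = m * (h' y * y - h y) / y\<^sup>2"
      by (simp add: algebra_simps power2_eq_square)
    ultimately have "((\<lambda>y. slope_lev k (m * h y / y)) has_real_derivative
        ?u / ?q * (m * (h' y * y - h y) / y\<^sup>2)) (at y)"
      by (simp only:)
    then show "(F has_real_derivative 1 / y + ?u / ?q * (m * (h' y * y - h y) / y\<^sup>2)) (at y)"
      unfolding F_def by (rule DERIV_add[OF DERIV_ln_divide[OF yp]])
    have "y - 2 * k * h y + m * h y * h' y > 0"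
      using k cross_plus[OF yp] cross_minus[OF yp] by (auto simp: is_zone_def algebra_simps)
    then have pos: "m * y * (y - 2 * k * h y + m * h y * h' y) > 0" 
      using yp m_pos by simp
    have gen: "1 / y + c / y / q * (n / y\<^sup>2) = (y\<^sup>2 * q + c * n) / (y ^ 3 * q)" if "q > 0" for c q n :: real
      using yp that by (simp add: field_simps power2_eq_square power3_eq_cube)
    have "y\<^sup>2 * ?q = y\<^sup>2 + (y * (k - ?u))\<^sup>2"
      by (simp only: power_mult_distrib distrib_left mult_1_right)
    also have "y * (k - ?u) = k * y - m * h y" using yp by (simp add: right_diff_distrib)
    finally have sq: "y\<^sup>2 * ?q = y\<^sup>2 + (k * y - m * h y)\<^sup>2" .
    have "1 / y + ?u / ?q * (m * (h' y * y - h y) / y\<^sup>2)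
        = (y\<^sup>2 * ?q + m * h y * (m * (h' y * y - h y))) / (y ^ 3 * ?q)"
      by (rule gen[OF q])
    also have "y\<^sup>2 * ?q + m * h y * (m * (h' y * y - h y))
        = (1 + k\<^sup>2) * y\<^sup>2 - 2 * k * m * y * h y + m\<^sup>2 * h y * h' y * y"
      unfolding sq by (simp only: power2_eq_square algebra_simps)
    also have "\<dots> = m * (y * y) - 2 * k * m * y * h y + m * m * h y * h' y * y"
      using is_zone_sq[OF k] by (simp only: power2_eq_square add.commute)
    also have "\<dots> = m * y * (y - 2 * k * h y + m * h y * h' y)"
      by (simp only: algebra_simps)
    also have "\<dots> / (y ^ 3 * ?q) > 0" using pos yp q by simp
    finally show "1 / y + ?u / ?q * (m * (h' y * y - h y) / y\<^sup>2) > 0" .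
  qed
  then show ?thesis using assms F by simp
qed

lemma lev_cp_less_iff:
  assumes "is_zone k" "0 < y1" "0 < y2"
  shows "lev k (cp y1) < lev k (cp y2) \<longleftrightarrow> y1 < y2"
  using lev_cp_strict_mono[OF assms(1)] assms by (metis less_asym' linorder_neqE)

lemma lev_cp_eq_iff:
  assumes "is_zone k" "0 < y1" "0 < y2"
  shows "lev k (cp y1) = lev k (cp y2) \<longleftrightarrow> y1 = y2"
  using lev_cp_less_iff[OF assms] lev_cp_less_iff[OF assms(1,3,2)] by auto

text \<open>The two derivatives of \<open>slope_lev\<close> differ by a positive multiple of the
  square of the slope, which vanishes only at 0. Hence 0 must not lie inside the interval, but may
  be an endpoint.\<close>

lemma jump_strict_mono:
  assumes "u < v" "0 \<notin> {u<..<v}" shows "jump u < jump v"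
proof (rule DERIV_pos_imp_increasing_open[OF \<open>u < v\<close>])
  have D: "(jump has_real_derivative x / (1 + (\<gamma> - x)\<^sup>2) - x / (1 + (- \<gamma> - x)\<^sup>2)) (at x)" for x
    unfolding jump_def by (intro DERIV_diff slope_lev_deriv)
  note q = one_plus_square_pos
  show "continuous_on {u..v} jump"
    using D by (intro continuous_at_imp_continuous_on) (auto intro: DERIV_isCont)
  fix x assume x: "u < x" "x < v"
  have "x / (1 + (\<gamma> - x)\<^sup>2) - x / (1 + (- \<gamma> - x)\<^sup>2)
      = 4 * \<gamma> * x\<^sup>2 / ((1 + (\<gamma> - x)\<^sup>2) * (1 + (- \<gamma> - x)\<^sup>2))"
    using q[of "\<gamma> - x"] q[of "- \<gamma> - x"] by (simp add: divide_simps power2_eq_square, simp add: algebra_simps)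
  also have "\<dots> > 0"
    using assms x gpos q[of "\<gamma> - x"] q[of "- \<gamma> - x"] by (intro divide_pos_pos mult_pos_pos) auto
  finally show "\<exists>y. (jump has_real_derivative y) (at x) \<and> 0 < y" using D by blast
qed

lemma lev_jump:
  assumes "y > 0"
  shows "lev \<gamma> (cp y) - lev (- \<gamma>) (cp y) = jump (m * h y / y)"
  using assms by (simp add: lev_upper jump_def)

lemma jump_0: "jump 0 = 0"
  by (simp add: jump_def slope_lev_def arctan_minus)

lemma lev_less_iff:
  assumes "y > 0"
  shows "lev (- \<gamma>) (cp y) < lev \<gamma> (cp y) \<longleftrightarrow> h y > 0"
    and "lev (- \<gamma>) (cp y) > lev \<gamma> (cp y) \<longleftrightarrow> h y < 0"
proof -
  have s: "sgn (m * h y / y) = sgn (h y)" using assms m_pos by (simp add: sgn_mult sgn_divide)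
  have "sgn (jump u) = sgn u" for u
    using jump_strict_mono[of 0 u] jump_strict_mono[of u 0] jump_0
    by (cases u "0 :: real" rule: linorder_cases) (auto simp: sgn_if)
  then have "sgn (lev \<gamma> (cp y) - lev (- \<gamma>) (cp y)) = sgn (h y)"
    using lev_jump[OF assms] s by metis
  then show "lev (- \<gamma>) (cp y) < lev \<gamma> (cp y) \<longleftrightarrow> h y > 0"
    and "lev (- \<gamma>) (cp y) > lev \<gamma> (cp y) \<longleftrightarrow> h y < 0"
    by (auto simp: sgn_if split: if_splits)
qed

lemma lev_eq_iff:
  assumes "y > 0"
  shows "lev (- \<gamma>) (cp y) = lev \<gamma> (cp y) \<longleftrightarrow> h y = 0"
  using lev_less_iff[OF assms] by (metis linorder_neq_iff)


section \<open>Where a spiral meets the switching curve\<close>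

lemma H_eq: "H p = p $ 1 - h (max 0 (p $ 2))"
  by (simp add: switch_fun_def max_def h0)

lemma H_lower: "p $ 2 \<le> 0 \<Longrightarrow> H p = p $ 1"
  by (simp add: switch_fun_def)

lemma continuous_h: "continuous_on {0..} h"
  using h_deriv by (auto simp: continuous_on_eq_continuous_within intro: DERIV_continuous)

text \<open>Writing the case split with \<open>max 0\<close> evaluates \<open>h\<close> only on
  \<open>{0..}\<close>, where it is known to be continuous; \<open>h 0 = 0\<close> glues the two
  pieces.\<close>

lemma continuous_H: "continuous_on UNIV H"
proof -
  have "continuous_on UNIV (\<lambda>p :: real^2. p $ 1 - h (max 0 (p $ 2)))"
    by (intro continuous_intros continuous_on_compose2[OF continuous_h]) auto
  then show ?thesis by (simp add: H_eq[abs_def])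
qed

lemma H_0 [simp]: "H 0 = 0"
  by (simp add: switch_fun_def)

lemma H_cp [simp]: "y > 0 \<Longrightarrow> H (cp y) = 0"
  by (simp add: switch_fun_def)

lemma continuous_on_vec2:
  fixes f :: "'a :: t2_space \<Rightarrow> real^2"
  assumes "continuous_on S (\<lambda>t. f t $ 1)" "continuous_on S (\<lambda>t. f t $ 2)"
  shows "continuous_on S f"
proof -
  have "continuous_on S (\<lambda>t. \<chi> i. f t $ i)"
    by (rule continuous_on_vec_lambda) (metis assms exhaust_2)
  then show ?thesis by (simp add: vec_lambda_beta)
qed

lemma continuous_sp [continuous_intros]:
  fixes f g :: "'a :: t2_space \<Rightarrow> real"
  shows "continuous_on S f \<Longrightarrow> continuous_on S g \<Longrightarrow> continuous_on S (\<lambda>t. sp k (f t) (g t))"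
  by (rule continuous_on_vec2)
    (auto intro!: continuous_intros continuous_on_cos continuous_on_sin)

lemma continuous_H_sp: "continuous_on S (\<lambda>\<theta>. H (sp k v \<theta>))"
  by (rule continuous_on_compose2[OF continuous_H]) (auto intro!: continuous_intros)

lemma H_eq_0_upper:
  assumes "H p = 0" "p $ 2 > 0" shows "p = cp (p $ 2)"
  using assms by (simp add: vec2_eq_iff switch_fun_def)

text \<open>Two meeting points on one spiral have the same level, and the level is injective along
  the curve.\<close>

lemma H_sp_unique:
  assumes k: "is_zone k" and "\<bar>s\<bar> < pi / 2" "\<bar>t\<bar> < pi / 2" "H (sp k v s) = 0" "H (sp k v t) = 0"
  shows "s = t"
proof -
  have *: "sp k v r = cp (sp k v r $ 2) \<and> sp k v r $ 2 > 0 \<and> lev k (sp k v r) = v"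
    if "\<bar>r\<bar> < pi / 2" "H (sp k v r) = 0" for r
  proof -
    have "sp k v r $ 2 > 0" using that(1) by (auto intro!: mult_pos_pos cos_gt_zero_pi)
    then show ?thesis using H_eq_0_upper[OF that(2)] lev_ang_sp(1)[of r k v] that(1) by simp
  qed
  have "sp k v s $ 2 = sp k v t $ 2"
    using *[of s] *[of t] assms lev_cp_eq_iff[OF k, of "sp k v s $ 2" "sp k v t $ 2"] by metis
  then have "sp k v s = sp k v t" using *[of s] *[of t] assms by metis
  moreover have "ang k (sp k v s) = s" "ang k (sp k v t) = t"
    using assms by (auto intro!: lev_ang_sp)
  ultimately show ?thesis by metis
qed

text \<open>The spiral of level \<open>v\<close> meets the switching curve once in the upper half-plane, at the angle \<open>Th k v\<close>
  and the height \<open>Yh k v\<close>.\<close>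

definition Th :: "real \<Rightarrow> real \<Rightarrow> real" where
  "Th k v = (SOME \<theta>. \<bar>\<theta>\<bar> < pi / 2 \<and> H (sp k v \<theta>) = 0)"

text \<open>At these two angles the spiral is on the x-axis, where \<open>H\<close> is the first
  coordinate. The opposite signs feed the intermediate value theorem.\<close>

lemma H_sp_ends:
  "H (sp k v (- (pi / 2))) > 0" "H (sp k v (pi / 2)) < 0"
  using m_pos by (simp_all add: H_lower)

lemma Th_root: "\<bar>Th k v\<bar> < pi / 2" "H (sp k v (Th k v)) = 0"
proof -
  obtain x where x: "- (pi / 2) \<le> x" "x \<le> pi / 2" "H (sp k v x) = 0"
    using IVT2'[of "\<lambda>\<theta>. H (sp k v \<theta>)" "pi / 2" 0 "- (pi / 2)"] H_sp_ends[of k v]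
      continuous_H_sp[of _ k v] by force
  have "x \<noteq> - (pi / 2)" using H_sp_ends(1)[of k v] x(3) by (metis less_irrefl)
  moreover have "x \<noteq> pi / 2" using H_sp_ends(2)[of k v] x(3) by (metis less_irrefl)
  ultimately have ex: "\<exists>\<theta>. \<bar>\<theta>\<bar> < pi / 2 \<and> H (sp k v \<theta>) = 0" using x by (intro exI[of _ x]) auto
  show "\<bar>Th k v\<bar> < pi / 2" "H (sp k v (Th k v)) = 0"
    using someI_ex[OF ex] unfolding Th_def by blast+
qed

lemma Th_unique: "is_zone k \<Longrightarrow> \<bar>\<theta>\<bar> < pi / 2 \<Longrightarrow> H (sp k v \<theta>) = 0 \<Longrightarrow> \<theta> = Th k v"
  using H_sp_unique Th_root by blast

text \<open>A wrong sign would produce, by the intermediate value theorem towards the end of the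
  half turn on the same side, a second zero of \<open>H\<close> on the spiral.\<close>

lemma H_sp_upper:
  assumes k: "is_zone k" and "\<bar>\<theta>\<bar> \<le> pi / 2"
  shows "\<theta> < Th k v \<Longrightarrow> H (sp k v \<theta>) > 0" "\<theta> > Th k v \<Longrightarrow> H (sp k v \<theta>) < 0"
proof -
  note T = Th_root[of k v]
  show "H (sp k v \<theta>) > 0" if "\<theta> < Th k v"
  proof (rule ccontr)
    assume "\<not> ?thesis"
    then obtain x where x: "- (pi / 2) \<le> x" "x \<le> \<theta>" "H (sp k v x) = 0"
      using IVT2'[of "\<lambda>\<theta>. H (sp k v \<theta>)" "\<theta>" 0 "- (pi / 2)"] H_sp_ends[of k v]
        continuous_H_sp[of _ k v] assms(2) by force
    have "x \<noteq> - (pi / 2)" using H_sp_ends[of k v] x(3) by (metis less_irrefl)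
    then have "x = Th k v" using x that T by (intro Th_unique[OF k]) auto
    then show False using x that by simp
  qed
  show "H (sp k v \<theta>) < 0" if "\<theta> > Th k v"
  proof (rule ccontr)
    assume "\<not> ?thesis"
    then obtain x where x: "\<theta> \<le> x" "x \<le> pi / 2" "H (sp k v x) = 0"
      using IVT2'[of "\<lambda>\<theta>. H (sp k v \<theta>)" "pi / 2" 0 "\<theta>"] H_sp_ends[of k v]
        continuous_H_sp[of _ k v] assms(2) by force
    then have "x \<noteq> pi / 2" using H_sp_ends[of k v] x(3) by (metis less_irrefl)
    then have "x = Th k v" using x that T by (intro Th_unique[OF k]) auto
    then show False using x that by simp
  qed
qed

definition Yh :: "real \<Rightarrow> real \<Rightarrow> real" where
  "Yh k v = sp k v (Th k v) $ 2"

lemma Yh_pos: "Yh k v > 0"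
  unfolding Yh_def using Th_root(1)[of k v] by (auto intro!: mult_pos_pos cos_gt_zero_pi)

lemma sp_Th: "sp k v (Th k v) = cp (Yh k v)"
  using H_eq_0_upper Th_root(2) Yh_pos unfolding Yh_def by blast

lemma lev_Yh: "lev k (cp (Yh k v)) = v" and ang_Yh: "ang k (cp (Yh k v)) = Th k v"
  using lev_ang_sp[of "Th k v" k v] Th_root(1)[of k v] by (auto simp flip: sp_Th)

lemma Yh_lev: "is_zone k \<Longrightarrow> y > 0 \<Longrightarrow> Yh k (lev k (cp y)) = y"
  using lev_cp_eq_iff Yh_pos lev_Yh by blast

lemma Th_lev: "is_zone k \<Longrightarrow> y > 0 \<Longrightarrow> Th k (lev k (cp y)) = ang k (cp y)"
  using ang_Yh[of k "lev k (cp y)"] Yh_lev by simp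

text \<open>The angles at which the spiral of level \<open>v\<close> enters and leaves the zone \<open>k\<close>. The angles \<open>\<alpha> - pi\<close> and
  \<open>pi - \<alpha>\<close> are those of the negative \<open>y\<close>-axis in the right and left coordinates.\<close>

definition lo :: "real \<Rightarrow> real \<Rightarrow> real" where
  "lo k v = (if k < 0 then Th k v else \<alpha> - pi)"

definition hi :: "real \<Rightarrow> real \<Rightarrow> real" where
  "hi k v = (if k < 0 then pi - \<alpha> else Th k v)"

text \<open>Time equals angle, so \<open>pi / 2 - \<alpha>\<close> is a uniform positive lower bound
  for the time needed to traverse a zone. It rules out an accumulation of crossings.\<close>

lemma lo_hi_bounds: "- pi < lo k v" "hi k v < pi" "hi k v - lo k v \<ge> pi / 2 - \<alpha>" "lo k v < hi k v"
  using Th_root(1)[of k v] alpha_bounds by (auto simp: lo_def hi_def)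

text \<open>In the lower half-plane \<open>H\<close> is the first coordinate, and since
  \<open>tan \<alpha> = \<gamma>\<close> the factor \<open>k * cos \<theta> - sin \<theta>\<close>
  becomes a shifted sine by the addition formula.\<close>

lemma zone_H_lower:
  assumes k: "is_zone k" and "cos \<theta> < 0"
  shows "sgn (k * H (sp k v \<theta>)) = sgn (sin (\<alpha> - sgn k * \<theta>))"
proof -
  have "k * (k * cos \<theta> - sin \<theta>) = \<gamma> / cos \<alpha> * sin (\<alpha> - sgn k * \<theta>)"
    using k gpos cos_alpha_pos by (auto simp: is_zone_def sin_diff sin_add sin_alpha algebra_simps power2_eq_square)
  moreover have "H (sp k v \<theta>) = exp (v + k * \<theta>) * (k * cos \<theta> - sin \<theta>) / m"
    using assms(2) by (simp add: H_lower mult_nonneg_nonpos)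
  ultimately have "k * H (sp k v \<theta>) = exp (v + k * \<theta>) / m * (\<gamma> / cos \<alpha>) * sin (\<alpha> - sgn k * \<theta>)"
    by (metis mult.assoc mult.left_commute times_divide_eq_left times_divide_eq_right)
  moreover have "exp (v + k * \<theta>) / m * (\<gamma> / cos \<alpha>) > 0"
    using gpos cos_alpha_pos m_pos by (intro mult_pos_pos divide_pos_pos) auto
  ultimately show ?thesis by (metis mult_1 sgn_mult sgn_pos)
qed

lemma cos_neg_outer: "pi / 2 < \<bar>\<theta>\<bar> \<Longrightarrow> \<bar>\<theta>\<bar> \<le> pi \<Longrightarrow> cos \<theta> < 0"
  using sin_gt_zero[of "\<bar>\<theta>\<bar> - pi / 2"] by (simp add: sin_diff)

text \<open>The angles up to \<open>pi / 2\<close> are settled by the unique root in the upper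
  half-plane, the others by the shifted sine. Keeping all three signs together lets the converses
  follow by trichotomy.\<close>

lemma zone_sign_aux:
  assumes k: "is_zone k" and "\<bar>\<theta>\<bar> \<le> pi"
  shows "(lo k v < \<theta> \<and> \<theta> < hi k v \<longrightarrow> k * H (sp k v \<theta>) > 0) \<and>
    (\<theta> = lo k v \<or> \<theta> = hi k v \<longrightarrow> k * H (sp k v \<theta>) = 0) \<and>
    (\<theta> < lo k v \<or> \<theta> > hi k v \<longrightarrow> k * H (sp k v \<theta>) < 0)"
proof (cases "\<bar>\<theta>\<bar> \<le> pi / 2")
  case True
  consider "k > 0" "k = \<gamma>" | "k < 0" "k = - \<gamma>" using k gpos by (auto simp: is_zone_def)
  then show ?thesis
    using H_sp_upper[OF k True, of v] Th_root[of k v] True alpha_bounds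
    by cases (auto simp: lo_def hi_def mult_neg_pos mult_pos_neg mult_neg_neg)
next
  case False
  have c: "cos \<theta> < 0" using False assms by (intro cos_neg_outer) auto
  have s: "sgn (k * H (sp k v \<theta>)) = sgn (sin (\<alpha> - sgn k * \<theta>))" by (rule zone_H_lower[OF k c])
  \<comment> \<open>Reflecting the angle by the sign of \<open>k\<close> lets one discussion of
    \<open>sin (\<alpha> - t)\<close> serve both zones.\<close>
  define t where "t = sgn k * \<theta>"
  have P: "sin (\<alpha> - t) > 0 \<Longrightarrow> k * H (sp k v \<theta>) > 0" "sin (\<alpha> - t) < 0 \<Longrightarrow> k * H (sp k v \<theta>) < 0"
    "sin (\<alpha> - t) = 0 \<Longrightarrow> k * H (sp k v \<theta>) = 0"
    using s unfolding t_def by (metis sgn_greater, metis sgn_less, metis sgn_0_0)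
  have "sgn k = 1 \<or> sgn k = - 1" using k gpos by (auto simp: is_zone_def)
  then have t: "pi / 2 < \<bar>t\<bar>" "\<bar>t\<bar> \<le> pi" using False assms by (auto simp: t_def)
  have S: "t > 0 \<Longrightarrow> sin (\<alpha> - t) < 0" "t < 0 \<Longrightarrow> t > \<alpha> - pi \<Longrightarrow> sin (\<alpha> - t) > 0"
    "t < \<alpha> - pi \<Longrightarrow> sin (\<alpha> - t) < 0" "t = \<alpha> - pi \<Longrightarrow> sin (\<alpha> - t) = 0"
    using sin_gt_zero[of "t - \<alpha>"] sin_gt_zero[of "\<alpha> - t"] sin_lt_zero[of "\<alpha> - t"] t alpha_bounds
      sin_minus[of "t - \<alpha>"] by auto
  consider "sgn k = 1" "k > 0" | "sgn k = - 1" "k < 0" using k gpos by (auto simp: is_zone_def)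
  then show ?thesis
  proof cases
    case 1
    then have "t = \<theta>" by (simp add: t_def)
    then show ?thesis using 1 P S t Th_root(1)[of k v] alpha_bounds
      unfolding lo_def hi_def abs_less_iff abs_le_iff
      by (cases "\<theta> > 0") (auto simp del: mult_eq_0_iff zero_less_mult_iff mult_less_0_iff simp: abs_if split: if_splits)
  next
    case 2
    then have "t = - \<theta>" by (simp add: t_def)
    then show ?thesis using 2 P S t Th_root(1)[of k v] alpha_bounds
      unfolding lo_def hi_def abs_less_iff abs_le_iff
      by (cases "\<theta> > 0") (auto simp del: mult_eq_0_iff zero_less_mult_iff mult_less_0_iff simp: abs_if split: if_splits)
  qed
qed

lemma zone_sign:
  assumes k: "is_zone k" and "\<bar>\<theta>\<bar> \<le> pi"
  shows "k * H (sp k v \<theta>) > 0 \<longleftrightarrow> lo k v < \<theta> \<and> \<theta> < hi k v"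
    and "H (sp k v \<theta>) = 0 \<longleftrightarrow> \<theta> = lo k v \<or> \<theta> = hi k v"
proof -
  note z = zone_sign_aux[OF assms, of v] 
  show "k * H (sp k v \<theta>) > 0 \<longleftrightarrow> lo k v < \<theta> \<and> \<theta> < hi k v"
    using z by (metis less_irrefl linorder_neqE_linordered_idom order_less_asym)
  show "H (sp k v \<theta>) = 0 \<longleftrightarrow> \<theta> = lo k v \<or> \<theta> = hi k v"
    using z is_zone_nz[OF k] by (metis less_irrefl linorder_neqE_linordered_idom mult_eq_0_iff)
qed

text \<open>The exponents \<open>k * \<theta>\<close> coincide and both points have
  \<open>x = 0\<close>. So the level is carried unchanged from the left to the right across the
  negative y-axis.\<close>

lemma sp_axis: "sp (- \<gamma>) v (pi - \<alpha>) = sp \<gamma> v (\<alpha> - pi)"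
proof -
  have "cos (\<alpha> - pi) = - cos \<alpha>" "sin (\<alpha> - pi) = - sin \<alpha>" "cos (pi - \<alpha>) = - cos \<alpha>" "sin (pi - \<alpha>) = sin \<alpha>"
    by (simp_all add: cos_diff sin_diff)
  then show ?thesis by (simp add: vec2_eq_iff sin_alpha algebra_simps)
qed


section \<open>Solutions follow spirals through a zone\<close>

lemma pw_field_zone:
  assumes "is_zone k" "k * H p > 0"
  shows "pw_field \<gamma> h p = vector [2 * k * p $ 1 - p $ 2, m * p $ 1]"
proof -
  consider "k = \<gamma>" "\<not> H p < 0" | "k = - \<gamma>" "H p < 0"
    using assms gpos by (auto simp: is_zone_def zero_less_mult_iff)
  then show ?thesis
    by cases (auto simp: pw_field_def G_minus_def G_plus_def vec2_eq_iff matrix_vector_mult_def sum_2)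
qed

lemma bounded_linear_Zc: "bounded_linear (Zc k)"
  unfolding linear_conv_bounded_linear[symmetric]
  by (rule linearI) (auto simp: Zc_def complex_eq_iff algebra_simps)

text \<open>In the coordinate the equation is \<open>Z' = (k + i) Z\<close>, so multiplying by the
  inverse exponential gives a constant. The two endpoints may be crossings without a derivative;
  continuity is enough there because a finite exceptional set is harmless.\<close>

lemma flow_segment:
  assumes k: "is_zone k" and "a < b" and cont: "continuous_on {a..b} X"
    and D: "\<And>t. a < t \<Longrightarrow> t < b \<Longrightarrow>
      (X has_vector_derivative vector [2 * k * X t $ 1 - X t $ 2, m * X t $ 1]) (at t)"
    and Xa: "X a = sp k v \<theta>" and t: "t \<in> {a..b}"
  shows "X t = sp k v (\<theta> + (t - a))"
proof -
  let ?c = "Complex k 1"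
  define f where "f t = exp ((a - t) *\<^sub>R ?c) * Zc k (X t)" for t
  have "f t = f a"
  proof (rule has_derivative_zero_unique_strong_convex[of "{a..b}" "{a, b}" f a "f a"])
    show "continuous_on {a..b} f"
      unfolding f_def
      by (intro continuous_intros bounded_linear.continuous_on[OF bounded_linear_Zc] cont)
    fix s assume s: "s \<in> {a..b} - {a, b}"
    have 1: "((\<lambda>t. Zc k (X t)) has_vector_derivative ?c * Zc k (X s)) (at s)"
    proof -
      have "Zc k (vector [2 * k * X s $ 1 - X s $ 2, m * X s $ 1]) = ?c * Zc k (X s)"
        using is_zone_sq[OF k] by (simp add: Zc_def complex_eq_iff algebra_simps power2_eq_square)
      then show ?thesis
        using bounded_linear.has_vector_derivative[OF bounded_linear_Zc D[of s], of k] s by simp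
    qed
    have 2: "((\<lambda>t. exp ((a - t) *\<^sub>R ?c)) has_vector_derivative - ?c * exp ((a - s) *\<^sub>R ?c)) (at s)"
    proof -
      have "((\<lambda>z. exp ((of_real a - z) * ?c)) has_field_derivative exp ((of_real a - of_real s) * ?c) * - ?c) (at (of_real s))"
        by (auto intro!: derivative_eq_intros)
      from has_vector_derivative_real_field[OF this]
      show ?thesis by (simp add: scaleR_conv_of_real mult.commute)
    qed
    have "(f has_vector_derivative exp ((a - s) *\<^sub>R ?c) * (?c * Zc k (X s))
       + (- ?c * exp ((a - s) *\<^sub>R ?c)) * Zc k (X s)) (at s)"
      unfolding f_def by (rule has_vector_derivative_mult[OF 2 1])
    then have "(f has_vector_derivative 0) (at s)" by simp
    then show "(f has_derivative (\<lambda>h. 0)) (at s within {a..b})"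
      by (simp add: has_vector_derivative_def has_derivative_at_withinI)
  qed (use assms in auto)
  then have "exp ((t - a) *\<^sub>R ?c) * (exp ((a - t) *\<^sub>R ?c) * Zc k (X t)) = exp ((t - a) *\<^sub>R ?c) * Zc k (X a)"
    by (simp add: f_def)
  moreover have "exp ((t - a) *\<^sub>R ?c) * exp ((a - t) *\<^sub>R ?c) = 1"
    by (simp flip: exp_add scaleR_add_left)
  ultimately have "Zc k (X t) = exp ((t - a) *\<^sub>R ?c) * Zc k (X a)"
    by (simp flip: mult.assoc)
  also have "\<dots> = exp ((t - a) *\<^sub>R ?c + Complex (v + k * \<theta>) \<theta>)"
    by (simp add: Xa Zc_sp exp_add)
  also have "(t - a) *\<^sub>R ?c + Complex (v + k * \<theta>) \<theta> = Complex (v + k * (\<theta> + (t - a))) (\<theta> + (t - a))"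
    by (simp add: complex_eq_iff algebra_simps)
  finally show ?thesis by (intro Zc_inj[of k]) (simp add: Zc_sp)
qed

lemma zone_segment:
  assumes sol: "solution_on \<gamma> h I X" and I: "{a<..<b} \<subseteq> interior I" "{a..b} \<subseteq> I"
    and k: "is_zone k" and "a < b" and pos: "\<And>t. a < t \<Longrightarrow> t < b \<Longrightarrow> k * H (X t) > 0"
    and Xa: "X a = sp k v \<theta>" and t: "t \<in> {a..b}"
  shows "X t = sp k v (\<theta> + (t - a))"
proof (rule flow_segment[where X = X, OF k \<open>a < b\<close> _ _ Xa t])
  show "continuous_on {a..b} X"
    using sol I continuous_on_subset by (auto simp: solution_on_def)
  fix t assume t: "a < t" "t < b"
  then have "H (X t) \<noteq> 0" using pos[of t] by auto
  moreover have "t \<in> interior I" using t I by auto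
  ultimately have "(X has_vector_derivative pw_field \<gamma> h (X t)) (at t)"
    using sol by (auto simp: solution_on_def)
  then show "(X has_vector_derivative vector [2 * k * X t $ 1 - X t $ 2, m * X t $ 1]) (at t)"
    using pw_field_zone[OF k pos[OF t]] by simp
qed

lemma solution_continuous_H:
  "solution_on \<gamma> h I X \<Longrightarrow> S \<subseteq> I \<Longrightarrow> continuous_on S (\<lambda>t. H (X t))"
  by (rule continuous_on_compose2[OF continuous_H]) (auto simp: solution_on_def intro: continuous_on_subset)

text \<open>The crossing condition, or continuity of \<open>H\<close> off the curve, fixes the sign
  of \<open>H\<close> just after \<open>t0\<close>. At a crossing \<open>k\<close> is therefore the
  zone being entered. The angle cannot equal \<open>hi\<close>, since the spiral would leave the
  zone at once.\<close>

lemma phase_start: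
  assumes sol: "solution_on \<gamma> h I X" and I: "{t0..} \<subseteq> interior I" and nz: "X t0 \<noteq> 0"
  obtains k e where "is_zone k" "e > 0" "\<And>s. t0 < s \<Longrightarrow> s < t0 + e \<Longrightarrow> k * H (X s) > 0"
    "lo k (lev k (X t0)) \<le> ang k (X t0)" "ang k (X t0) < hi k (lev k (X t0))"
proof -
  have "\<exists>k e. is_zone k \<and> e > 0 \<and> (\<forall>s. t0 < s \<longrightarrow> s < t0 + e \<longrightarrow> k * H (X s) > 0)"
  proof -
    have "eventually (\<lambda>s. H (X s) > 0) (at_right t0) \<or> eventually (\<lambda>s. H (X s) < 0) (at_right t0)"
    proof (cases "H (X t0) = 0")
      case True
      moreover have "t0 \<in> interior I" using I by auto
      ultimately have "crosses_at h X t0" using sol nz unfolding solution_on_def by auto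
      then show ?thesis unfolding crosses_at_def by blast
    next
      case False
      have "continuous_on (interior I) (\<lambda>t. H (X t))"
        using solution_continuous_H[OF sol interior_subset] .
      then have "isCont (\<lambda>t. H (X t)) t0"
        using I by (auto simp: continuous_on_eq_continuous_at)
      then have T: "((\<lambda>t. H (X t)) \<longlongrightarrow> H (X t0)) (at_right t0)"
        unfolding isCont_def by (rule filterlim_mono) (auto simp: at_le)
      show ?thesis
        using order_tendstoD[OF T] False by (cases "H (X t0) > 0") auto
    qed
    then obtain e where "e > 0" "(\<forall>s. t0 < s \<longrightarrow> s < t0 + e \<longrightarrow> H (X s) > 0) \<or> (\<forall>s. t0 < s \<longrightarrow> s < t0 + e \<longrightarrow> H (X s) < 0)"
      unfolding eventually_at_right_field by (metis add.commute diff_add_cancel diff_gt_0_iff_gt)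
    then show ?thesis
      using gpos is_zone_gamma is_zone_minus mult_pos_pos[OF gpos] mult_neg_neg[of "- \<gamma>"] by (metis neg_less_0_iff_less)
  qed
  then obtain k e where k: "is_zone k" and e: "e > 0"
    and pos: "\<And>s. t0 < s \<Longrightarrow> s < t0 + e \<Longrightarrow> k * H (X s) > 0" by blast
  let ?v = "lev k (X t0)" and ?\<theta> = "ang k (X t0)"
  have X0: "X t0 = sp k ?v ?\<theta>" using sp_lev_ang[OF nz] by simp
  have th: "- pi < ?\<theta>" "?\<theta> \<le> pi" "\<bar>?\<theta>\<bar> \<le> pi" using ang_bounds[OF nz, of k] by auto
  have seg: "X s = sp k ?v (?\<theta> + (s - t0))" if "t0 \<le> s" "s < t0 + e" for s
  proof (cases "s = t0")
    case False
    have "{t0<..<s} \<subseteq> interior I" "{t0..s} \<subseteq> I" using I interior_subset[of I] by auto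
    then show ?thesis
      using that False by (intro zone_segment[OF sol _ _ k _ pos X0, of s]) auto
  qed (use X0 in simp)
  have "k * H (X t0) \<ge> 0"
  proof (rule ccontr)
    assume "\<not> k * H (X t0) \<ge> 0"
    then have "k * H (X t0) < 0" by simp
    moreover have "((\<lambda>t. k * H (X t)) \<longlongrightarrow> k * H (X t0)) (at t0 within interior I)"
      using solution_continuous_H[OF sol interior_subset] I
      by (intro tendsto_mult_left) (auto simp: continuous_on_def)
    then have "((\<lambda>t. k * H (X t)) \<longlongrightarrow> k * H (X t0)) (at_right t0)"
      by (rule tendsto_within_subset) (use I in auto)
    ultimately have "\<forall>\<^sub>F t in at_right t0. k * H (X t) < 0"
      using order_tendstoD(2) by blast
    moreover have "\<forall>\<^sub>F t in at_right t0. k * H (X t) > 0"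
      unfolding eventually_at_right_field using pos e by (intro exI[of _ "t0 + e"]) auto
    ultimately have "\<forall>\<^sub>F t in at_right t0. False"
      by eventually_elim auto
    then show False by simp
  qed
  then have range: "lo k ?v \<le> ?\<theta>" "?\<theta> \<le> hi k ?v"
    using zone_sign_aux[OF k th(3), of ?v] X0 by (metis not_le)+
  have "?\<theta> \<noteq> hi k ?v"
  proof
    assume eq: "?\<theta> = hi k ?v"
    \<comment> \<open>The step is bounded by half of \<open>pi - \<theta>\<close> as well, so that
      the new angle stays within the range covered by \<open>zone_sign_aux\<close>.\<close>
    define s where "s = t0 + min (e / 2) ((pi - ?\<theta>) / 2)"
    have "?\<theta> < pi" using lo_hi_bounds eq by metis
    then have s: "t0 < s" "s < t0 + e" "?\<theta> + (s - t0) \<le> pi"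
      using e by (auto simp: s_def min_def field_simps)
    then have "\<bar>?\<theta> + (s - t0)\<bar> \<le> pi" using th by auto
    then have "k * H (X s) < 0"
      using zone_sign_aux[OF k, of "?\<theta> + (s - t0)" ?v] seg[of s] s eq by auto
    then show False using pos[of s] s by simp
  qed
  then have "?\<theta> < hi k ?v" using range by simp
  with range(1) show ?thesis using k e pos that by blast
qed

text \<open>A first-exit argument: up to the first time at which \<open>k * H\<close> fails to be
  positive the solution is on its spiral, but the spiral has \<open>k * H\<close> positive at every
  angle strictly between \<open>lo\<close> and \<open>hi\<close>, including the supposed exit
  angle.\<close>

lemma phase:
  assumes sol: "solution_on \<gamma> h I X" and I: "{t0..} \<subseteq> interior I" and nz: "X t0 \<noteq> 0"
  obtains k where "is_zone k"
    "lo k (lev k (X t0)) \<le> ang k (X t0)" "ang k (X t0) < hi k (lev k (X t0))"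
    "\<And>t. t0 \<le> t \<Longrightarrow> t \<le> t0 + (hi k (lev k (X t0)) - ang k (X t0)) \<Longrightarrow>
      X t = sp k (lev k (X t0)) (ang k (X t0) + (t - t0))"
proof -
  obtain k e where k: "is_zone k" and e: "e > 0"
    and pos: "\<And>s. t0 < s \<Longrightarrow> s < t0 + e \<Longrightarrow> k * H (X s) > 0"
    and lh: "lo k (lev k (X t0)) \<le> ang k (X t0)" "ang k (X t0) < hi k (lev k (X t0))"
    using phase_start[OF assms] by blast
  let ?v = "lev k (X t0)" and ?\<theta> = "ang k (X t0)"
  let ?T = "t0 + (hi k ?v - ?\<theta>)"
  have X0: "X t0 = sp k ?v ?\<theta>" using sp_lev_ang[OF nz] by simp
  have sub: "{t0<..<s} \<subseteq> interior I" "{t0..s} \<subseteq> I" for s using I interior_subset[of I] by auto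
  have good: "k * H (X s) > 0" if s: "t0 < s" "s < ?T" for s
  proof (rule ccontr)
    assume bad: "\<not> k * H (X s) > 0"
    \<comment> \<open>The search for the exit starts inside the interval given by
      \<open>phase_start\<close>, because \<open>H\<close> may vanish at \<open>t0\<close>
      itself.\<close>
    define a where "a = t0 + min (e / 2) ((s - t0) / 2)"
    have a: "t0 < a" "a < t0 + e" "a < s" using e s by (auto simp: a_def min_def field_simps)
    define Z where "Z = {t \<in> {a..s}. k * H (X t) \<le> 0}"
    have "continuous_on {a..s} (\<lambda>t. k * H (X t))"
      using sub(2)[of s] a by (intro continuous_intros solution_continuous_H[OF sol]) auto
    then have "closed ({a..s} \<inter> (\<lambda>t. k * H (X t)) -` {..0})"
      by (intro continuous_closed_preimage closed_atLeastAtMost closed_atMost)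
    moreover have "Z = {a..s} \<inter> (\<lambda>t. k * H (X t)) -` {..0}" by (auto simp: Z_def)
    ultimately have "closed Z" by simp
    moreover have "Z \<noteq> {}" "bdd_below Z" using bad a by (auto simp: Z_def)
    ultimately have c: "Inf Z \<in> Z" by (rule closed_contains_Inf[rotated 2])
    define c where "c = Inf Z"
    have c1: "a \<le> c" "c \<le> s" "k * H (X c) \<le> 0" using c by (auto simp: Z_def c_def)
    have "c \<noteq> a" using pos[OF a(1,2)] c1 by auto
    have before: "k * H (X t) > 0" if "t0 < t" "t < c" for t
    proof (cases "t < a")
      case False
      have "t \<notin> Z" using that cInf_lower[OF _ \<open>bdd_below Z\<close>, of t] by (auto simp: c_def)
      then show ?thesis using that False c1 by (auto simp: Z_def)
    qed (use pos that a in auto)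
    have "X c = sp k ?v (?\<theta> + (c - t0))"
      using a c1 by (intro zone_segment[OF sol sub(1)[of c] sub(2)[of c] k _ before X0]) auto
    moreover have "\<bar>?\<theta> + (c - t0)\<bar> \<le> pi" "lo k ?v < ?\<theta> + (c - t0)" "?\<theta> + (c - t0) < hi k ?v"
      using lh a c1 s lo_hi_bounds[of k ?v] by auto
    ultimately have "k * H (X c) > 0"
      using zone_sign(1)[OF k] by auto
    then show False using c1 by simp
  qed
  have "X t = sp k ?v (?\<theta> + (t - t0))" if "t0 \<le> t" "t \<le> ?T" for t
    using that lh by (intro zone_segment[OF sol sub k _ good X0]) auto
  then show ?thesis using that k lh by blast
qed


section \<open>One turn and the return map\<close>

text \<open>The level of a point in its own zone. It is constant along solutions except for the jump from \<open>B y\<close> to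
  \<open>A y\<close> just after crossing the curve at height \<open>y\<close>.\<close>

definition W :: "real^2 \<Rightarrow> real" where
  "W p = (if H p < 0 then lev (- \<gamma>) p else lev \<gamma> p)"

definition arc :: "real \<Rightarrow> real \<Rightarrow> (real^2) set" where
  "arc k v = sp k v ` {lo k v..hi k v}"

text \<open>One turn of a solution that leaves the switching curve with left level \<open>v\<close>.\<close>

definition ring :: "real \<Rightarrow> (real^2) set" where
  "ring v = arc (- \<gamma>) v \<union> arc \<gamma> v"

definition A :: "real \<Rightarrow> real" where "A y = lev (- \<gamma>) (cp y)"
definition B :: "real \<Rightarrow> real" where "B y = lev \<gamma> (cp y)"
definition ret :: "real \<Rightarrow> real" where "ret y = Yh \<gamma> (A y)"

lemma lo_hi_gamma [simp]: "lo \<gamma> v = \<alpha> - pi" "hi \<gamma> v = Th \<gamma> v" "lo (- \<gamma>) v = Th (- \<gamma>) v" "hi (- \<gamma>) v = pi - \<alpha>"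
  using gpos by (auto simp: lo_def hi_def)

lemma W_sp:
  assumes k: "is_zone k" and "lo k v < \<theta>" "\<theta> < hi k v"
  shows "W (sp k v \<theta>) = v"
proof -
  have b: "- pi < \<theta>" "\<theta> \<le> pi" "\<bar>\<theta>\<bar> \<le> pi" using assms lo_hi_bounds[of k v] by auto
  have "k * H (sp k v \<theta>) > 0" using zone_sign(1)[OF k b(3)] assms by simp
  then show ?thesis using k gpos lev_ang_sp(1)[OF b(1,2)]
    by (auto simp: W_def is_zone_def zero_less_mult_iff)
qed

text \<open>Both ends of a right arc have \<open>H = 0\<close>, where \<open>W\<close> takes the
  right level by definition. On the switching curve \<open>W\<close> is thus \<open>B\<close>, the
  level of the turn that ends there.\<close>

lemma W_boundary:
  "W (sp \<gamma> v (\<alpha> - pi)) = v" "W (sp \<gamma> v (Th \<gamma> v)) = v"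
proof -
  have "W (sp \<gamma> v \<theta>) = v" if th: "\<theta> = \<alpha> - pi \<or> \<theta> = Th \<gamma> v" for \<theta>
  proof -
    have b: "\<bar>\<theta>\<bar> \<le> pi" "- pi < \<theta>" "\<theta> \<le> pi" using th Th_root(1)[of \<gamma> v] alpha_bounds by auto
    have "H (sp \<gamma> v \<theta>) = 0" using zone_sign(2)[of \<gamma>, OF _ b(1)] th by simp
    then show ?thesis using lev_ang_sp(1)[OF b(2,3)] by (simp add: W_def)
  qed
  then show "W (sp \<gamma> v (\<alpha> - pi)) = v" "W (sp \<gamma> v (Th \<gamma> v)) = v" by blast+
qed

lemma W_cp: "y > 0 \<Longrightarrow> W (cp y) = B y"
  by (simp add: W_def B_def)

lemma A_less_iff: "0 < y1 \<Longrightarrow> 0 < y2 \<Longrightarrow> A y1 < A y2 \<longleftrightarrow> y1 < y2"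
  and B_less_iff: "0 < y1 \<Longrightarrow> 0 < y2 \<Longrightarrow> B y1 < B y2 \<longleftrightarrow> y1 < y2"
  by (simp_all add: A_def B_def lev_cp_less_iff)

lemma ret_pos: "ret y > 0"
  by (simp add: ret_def Yh_pos)

lemma B_ret: "B (ret y) = A y"
  by (simp add: B_def ret_def lev_Yh)

lemma Yh_B: "y > 0 \<Longrightarrow> Yh \<gamma> (B y) = y"
  by (simp add: B_def Yh_lev)

lemma ret_mono: "0 < y1 \<Longrightarrow> y1 < y2 \<Longrightarrow> ret y1 < ret y2"
  using A_less_iff[of y1 y2] B_less_iff[OF ret_pos ret_pos, of y1 y2] by (simp add: B_ret)

text \<open>Since \<open>B\<close> is increasing and \<open>B (ret y) = A y\<close>, comparing
  \<open>ret y\<close> with \<open>y\<close> amounts to comparing \<open>A y\<close> with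
  \<open>B y\<close>.\<close>

lemma ret_sign:
  assumes "y > 0"
  shows "h y > 0 \<Longrightarrow> ret y < y" "h y < 0 \<Longrightarrow> ret y > y" "h y = 0 \<Longrightarrow> ret y = y"
proof -
  show "h y > 0 \<Longrightarrow> ret y < y"
    using B_less_iff[OF ret_pos assms, of y] lev_less_iff(1)[OF assms] by (simp add: B_ret) (simp add: A_def B_def)
  show "h y < 0 \<Longrightarrow> ret y > y"
    using B_less_iff[OF assms ret_pos, of y] lev_less_iff(2)[OF assms] by (simp add: B_ret) (simp add: A_def B_def)
  show "h y = 0 \<Longrightarrow> ret y = y"
    using lev_eq_iff[OF assms] Yh_B[OF assms] by (simp add: ret_def A_def B_def)
qed

text \<open>\<open>phase\<close> leaves the zone open. The left one is excluded because the left
  angle already has its final value \<open>pi - \<alpha>\<close> here. In \<open>left_phase\<close>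
  the right zone is excluded likewise, its final angle being \<open>Th \<gamma>\<close>.\<close>

lemma right_phase:
  assumes sol: "solution_on \<gamma> h I X" and I: "{t0..} \<subseteq> interior I" and X0: "X t0 = sp \<gamma> v (\<alpha> - pi)"
    and t: "t0 \<le> t" "t \<le> t0 + (Th \<gamma> v - (\<alpha> - pi))"
  shows "X t = sp \<gamma> v (\<alpha> - pi + (t - t0))"
proof -
  have la: "lev \<gamma> (X t0) = v" "ang \<gamma> (X t0) = \<alpha> - pi" "ang (- \<gamma>) (X t0) = pi - \<alpha>"
    using lev_ang_sp[of "\<alpha> - pi" \<gamma> v] lev_ang_sp[of "pi - \<alpha>" "- \<gamma>" v] alpha_bounds
    by (auto simp: X0 simp flip: sp_axis)
  have "X t0 \<noteq> 0" by (simp add: X0)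
  from phase[OF sol I this] obtain k where k: "is_zone k" "ang k (X t0) < hi k (lev k (X t0))"
    and ph: "\<And>t. t0 \<le> t \<Longrightarrow> t \<le> t0 + (hi k (lev k (X t0)) - ang k (X t0)) \<Longrightarrow>
      X t = sp k (lev k (X t0)) (ang k (X t0) + (t - t0))" by blast
  have "k = \<gamma>" using k la by (auto simp: is_zone_def)
  then show ?thesis using ph[of t] t la by simp
qed

lemma left_phase:
  assumes sol: "solution_on \<gamma> h I X" and I: "{t0..} \<subseteq> interior I"
    and X0: "X t0 = cp y" "y > 0"
    and t: "t0 \<le> t" "t \<le> t0 + (pi - \<alpha> - Th (- \<gamma>) (A y))"
  shows "X t = sp (- \<gamma>) (A y) (Th (- \<gamma>) (A y) + (t - t0))"
proof -
  have "X t0 \<noteq> 0" using X0 by (simp add: cp_nonzero)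
  from phase[OF sol I this] obtain k where k: "is_zone k" "ang k (X t0) < hi k (lev k (X t0))"
    and ph: "\<And>t. t0 \<le> t \<Longrightarrow> t \<le> t0 + (hi k (lev k (X t0)) - ang k (X t0)) \<Longrightarrow>
      X t = sp k (lev k (X t0)) (ang k (X t0) + (t - t0))" by blast
  have "ang k (X t0) = Th k (lev k (X t0))" using Th_lev[OF k(1) X0(2)] X0 by simp
  then have "k = - \<gamma>" using k by (auto simp: is_zone_def)
  then show ?thesis using ph[of t] t X0 Th_lev[of "- \<gamma>" y] by (simp add: A_def)
qed

lemma image_shift:
  fixes a b t0 :: real
  assumes "\<And>t. t0 \<le> t \<Longrightarrow> t \<le> t0 + (b - a) \<Longrightarrow> X t = f (a + (t - t0))"
  shows "X ` {t0..t0 + (b - a)} = f ` {a..b}"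
proof -
  have "X ` {t0..t0 + (b - a)} = (\<lambda>t. f (a + (t - t0))) ` {t0..t0 + (b - a)}"
    using assms by (intro image_cong) auto
  also have "\<dots> = f ` ((\<lambda>t. (a - t0) + t) ` {t0..t0 + (b - a)})"
    by (simp add: image_image algebra_simps)
  finally show ?thesis by simp
qed

text \<open>A left arc and then a right arc of the same level. The claim on \<open>W\<close> omits
  the start, where \<open>W\<close> is still \<open>B y\<close>, and includes the end, where
  \<open>B (ret y) = A y\<close>.\<close>

lemma loop:
  assumes sol: "solution_on \<gamma> h I X" and I: "{t0..} \<subseteq> interior I"
    and X0: "X t0 = cp y" "y > 0"
  shows "\<exists>t1 \<ge> t0 + (pi / 2 - \<alpha>). X t1 = cp (ret y) \<and> X ` {t0..t1} = ring (A y) \<and>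
    (\<forall>t. t0 < t \<and> t \<le> t1 \<longrightarrow> W (X t) = A y)"
proof -
  define v where "v = A y"
  define t' where "t' = t0 + (pi - \<alpha> - Th (- \<gamma>) v)"
  define t1 where "t1 = t' + (Th \<gamma> v - (\<alpha> - pi))"
  note L = left_phase[OF sol I X0, folded v_def]
  have len: "t' \<ge> t0 + (pi / 2 - \<alpha>)" "t1 \<ge> t'" "t0 < t'"
    using Th_root(1)[of "- \<gamma>" v] Th_root(1)[of \<gamma> v] alpha_bounds by (auto simp: t'_def t1_def)
  have X': "X t' = sp \<gamma> v (\<alpha> - pi)"
    using L[of t'] len by (simp add: t'_def sp_axis)
  have I': "{t'..} \<subseteq> interior I" using I len by auto
  note R = right_phase[OF sol I' X']
  have X1: "X t1 = cp (ret y)"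
    using R[of t1] len by (simp add: t1_def sp_Th ret_def v_def)
  have "X ` {t0..t'} = arc (- \<gamma>) v"
    unfolding t'_def arc_def lo_hi_gamma by (rule image_shift) (use L in auto)
  moreover have "X ` {t'..t1} = arc \<gamma> v"
    unfolding t1_def arc_def lo_hi_gamma by (rule image_shift) (use R in auto)
  moreover have "{t0..t1} = {t0..t'} \<union> {t'..t1}" using len by auto
  ultimately have im: "X ` {t0..t1} = ring v" by (simp add: ring_def image_Un)
  have "W (X t) = v" if that': "t0 < t" "t \<le> t1" for t
  proof -
    consider "t < t'" | "t = t'" | "t = t1" | "t' < t" "t < t1"
      using that' by (cases t t' rule: linorder_cases; cases "t = t1") auto
    then show ?thesis
    proof cases
      case 1
      then show ?thesis using L[of t] that' by (simp add: t'_def) (rule W_sp, auto)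
    next
      case 2
      then show ?thesis using X' W_boundary by simp
    next
      case 3
      then show ?thesis using X1 W_boundary(2)[of v] by (simp add: sp_Th ret_def v_def)
    next
      case 4
      then show ?thesis using R[of t] by (simp add: t1_def) (rule W_sp, auto)
    qed
  qed
  then show ?thesis using len X1 im v_def by (intro exI[of _ t1]) auto
qed

text \<open>\<open>W\<close> is the level with which the current turn ends on the curve: a point in
  the left zone keeps its level across the negative y-axis, and a point already on the upper curve
  is its own target, with \<open>t1 = t0\<close>.\<close>

lemma reach:
  assumes sol: "solution_on \<gamma> h I X" and I: "{t0..} \<subseteq> interior I" and nz: "X t0 \<noteq> 0"
  shows "\<exists>t1 \<ge> t0. X t1 = cp (Yh \<gamma> (W (X t0)))"
proof -
  from phase[OF assms] obtain k where k: "is_zone k"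
    and lh: "lo k (lev k (X t0)) \<le> ang k (X t0)" "ang k (X t0) < hi k (lev k (X t0))"
    and ph: "\<And>t. t0 \<le> t \<Longrightarrow> t \<le> t0 + (hi k (lev k (X t0)) - ang k (X t0)) \<Longrightarrow>
      X t = sp k (lev k (X t0)) (ang k (X t0) + (t - t0))" by blast
  let ?v = "lev k (X t0)" and ?\<theta> = "ang k (X t0)"
  let ?t = "t0 + (hi k ?v - ?\<theta>)"
  have X0: "X t0 = sp k ?v ?\<theta>" using sp_lev_ang[OF nz] by simp
  have end_t: "X ?t = sp k ?v (hi k ?v)" using ph[of ?t] lh by simp
  have "\<bar>?\<theta>\<bar> \<le> pi" using ang_bounds[OF nz, of k] by auto
  note z = zone_sign[OF k this, of ?v]
  consider "k = \<gamma>" | "k = - \<gamma>" "H (X t0) = 0" | "k = - \<gamma>" "H (X t0) \<noteq> 0"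
    using k by (auto simp: is_zone_def)
  then show ?thesis
  proof cases
    case 1
    have "\<gamma> * H (X t0) \<ge> 0" using zone_sign_aux[OF k \<open>\<bar>?\<theta>\<bar> \<le> pi\<close>, of ?v] lh X0 1
      by (metis le_less not_le)
    then have "\<not> H (X t0) < 0" using gpos mult_pos_neg not_le by blast
    then have "W (X t0) = ?v" by (simp add: W_def 1)
    then show ?thesis using end_t lh 1 by (intro exI[of _ ?t]) (simp add: sp_Th)
  next
    case 2
    then have "X t0 = cp (Yh k ?v)" using z(2) lh X0 sp_Th[of k ?v] by simp
    moreover from this have "W (X t0) = B (Yh k ?v)" using W_cp Yh_pos by metis
    ultimately show ?thesis using Yh_B[OF Yh_pos] by (intro exI[of _ t0]) simp
  next
    case 3
    then have "k * H (X t0) > 0" using z X0 lh by (metis le_less)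
    then have "W (X t0) = ?v" using 3 gpos by (simp add: W_def mult_less_0_iff)
    have I': "{?t..} \<subseteq> interior I" using I lh by auto
    have e: "X ?t = sp \<gamma> ?v (\<alpha> - pi)" using end_t 3 by (simp add: sp_axis)
    let ?s = "?t + (Th \<gamma> ?v - (\<alpha> - pi))"
    have len: "?s \<ge> ?t" using Th_root(1)[of \<gamma> ?v] alpha_bounds by auto
    then have "X ?s = sp \<gamma> ?v (Th \<gamma> ?v)"
      using right_phase[OF sol I' e, of ?s] by simp
    then show ?thesis using len lh \<open>W (X t0) = ?v\<close> by (intro exI[of _ ?s]) (simp add: sp_Th)
  qed
qed

section \<open>Successive turns and periodic solutions\<close>

lemma ret_iter_pos: "y > 0 \<Longrightarrow> (ret ^^ n) y > 0"
  by (cases n) (simp_all add: ret_pos)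

text \<open>The linear lower bound makes \<open>t n\<close> unbounded, so the half-open intervals
  from \<open>t n\<close> to \<open>t (Suc n)\<close> cover all times after
  \<open>t0\<close>.\<close>

definition visits :: "(real \<Rightarrow> real^2) \<Rightarrow> real \<Rightarrow> real \<Rightarrow> (nat \<Rightarrow> real) \<Rightarrow> bool" where
  "visits X t0 y t \<longleftrightarrow> t 0 = t0 \<and> (\<forall>n. t n \<ge> t0 + real n * (pi / 2 - \<alpha>)) \<and> (\<forall>n. t n < t (Suc n)) \<and>
    (\<forall>n. X ` {t n..t (Suc n)} = ring (A ((ret ^^ n) y))) \<and>
    (\<forall>n s. t n < s \<and> s \<le> t (Suc n) \<longrightarrow> W (X s) = A ((ret ^^ n) y))"

lemma visitsD:
  assumes "visits X t0 y t"
  shows "t 0 = t0" "t n \<ge> t0 + real n * (pi / 2 - \<alpha>)" "t n < t (Suc n)"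
    "X ` {t n..t (Suc n)} = ring (A ((ret ^^ n) y))"
    "t n < s \<Longrightarrow> s \<le> t (Suc n) \<Longrightarrow> W (X s) = A ((ret ^^ n) y)"
  using assms by (auto simp: visits_def)

lemma orbit_sequence:
  assumes sol: "solution_on \<gamma> h I X" and I: "{t0..} \<subseteq> interior I"
    and X0: "X t0 = cp y" "y > 0"
  obtains t where "visits X t0 y t"
proof -
  define P where "P n s \<longleftrightarrow> s \<ge> t0 \<and> X s = cp ((ret ^^ n) y) \<and> (n = 0 \<longrightarrow> s = t0)" for n s
  define Q where "Q n s s' \<longleftrightarrow> s' \<ge> s + (pi / 2 - \<alpha>) \<and> X ` {s..s'} = ring (A ((ret ^^ n) y)) \<and>
    (\<forall>r. s < r \<and> r \<le> s' \<longrightarrow> W (X r) = A ((ret ^^ n) y))" for n s s'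
  have "\<exists>s. P 0 s" using X0 by (auto simp: P_def)
  moreover have "\<exists>s'. P (Suc n) s' \<and> Q n s s'" if "P n s" for n s
  proof -
    have I': "{s..} \<subseteq> interior I" using I that by (auto simp: P_def)
    have Xs: "X s = cp ((ret ^^ n) y)" using that by (simp add: P_def)
    obtain s' where "s' \<ge> s + (pi / 2 - \<alpha>)" "X s' = cp (ret ((ret ^^ n) y))" "X ` {s..s'} = ring (A ((ret ^^ n) y))"
      "\<forall>r. s < r \<and> r \<le> s' \<longrightarrow> W (X r) = A ((ret ^^ n) y)"
      using loop[OF sol I' Xs ret_iter_pos[OF X0(2), of n]] by (elim exE conjE) blast
    then show ?thesis using that alpha_bounds by (intro exI[of _ s']) (auto simp: P_def Q_def)
  qed
  ultimately have "\<exists>t. \<forall>n. P n (t n) \<and> Q n (t n) (t (Suc n))"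
    by (rule dependent_nat_choice)
  then obtain t where t: "\<And>n. P n (t n)" "\<And>n. Q n (t n) (t (Suc n))"
    by blast
  have "t n \<ge> t0 + n * (pi / 2 - \<alpha>)" for n
  proof (induction n)
    case 0
    then show ?case using t(1)[of 0] by (simp add: P_def)
  next
    case (Suc n)
    have "t (Suc n) \<ge> t n + (pi / 2 - \<alpha>)" using t(2)[of n] by (simp add: Q_def)
    moreover have "real (Suc n) * (pi / 2 - \<alpha>) = real n * (pi / 2 - \<alpha>) + (pi / 2 - \<alpha>)"
      by (simp add: algebra_simps)
    ultimately show ?case using Suc by linarith
  qed
  moreover have "t n < t (Suc n)" for n using t(2)[of n] alpha_bounds by (simp add: Q_def)
  ultimately show ?thesis using t by (intro that[of t]) (auto simp: P_def Q_def visits_def)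
qed

lemma interval_index:
  fixes t :: "nat \<Rightarrow> real" and c :: real
  assumes "t 0 = t0" "\<And>n. t n \<ge> t0 + n * c" "c > 0" "s > t0"
  obtains n where "t n < s" "s \<le> t (Suc n)"
proof -
  obtain N :: nat where "(s - t0) / c < N" using reals_Archimedean2 by blast
  then have "s \<le> t N" using assms(2)[of N] \<open>c > 0\<close> by (simp add: field_simps)
  define m where "m = (LEAST n. s \<le> t n)"
  have m: "s \<le> t m" unfolding m_def using \<open>s \<le> t N\<close> by (rule LeastI)
  then have "m \<noteq> 0" using assms by (cases m) auto
  then obtain n where n: "m = Suc n" by (cases m) auto
  then have "\<not> s \<le> t n" using not_less_Least[of n "\<lambda>n. s \<le> t n"] by (simp add: m_def)
  then show ?thesis using that[of n] m n by simp
qed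

lemma ret_iter_le:
  assumes "y > 0" "h y > 0"
  shows "(ret ^^ Suc n) y < (ret ^^ n) y" "(ret ^^ n) y \<le> y"
proof -
  show *: "(ret ^^ Suc n) y < (ret ^^ n) y" for n
  proof (induction n)
    case 0
    then show ?case using assms ret_sign(1) by simp
  next
    case (Suc n)
    then show ?case
      using ret_mono[OF ret_iter_pos[OF assms(1)] Suc] unfolding funpow.simps o_def by blast
  qed
  show "(ret ^^ n) y \<le> y"
  proof (induction n)
    case (Suc n)
    then show ?case using *[of n] by linarith
  qed simp
qed

lemma ret_iter_ge:
  assumes "y > 0" "h y < 0"
  shows "(ret ^^ Suc n) y > (ret ^^ n) y" "(ret ^^ n) y \<ge> y"
proof -
  show *: "(ret ^^ Suc n) y > (ret ^^ n) y" for n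
  proof (induction n)
    case 0
    then show ?case using assms ret_sign(2) by simp
  next
    case (Suc n)
    then show ?case
      using ret_mono[OF ret_iter_pos[OF assms(1)] Suc] unfolding funpow.simps o_def by blast
  qed
  show "(ret ^^ n) y \<ge> y"
  proof (induction n)
    case (Suc n)
    then show ?case using *[of n] by linarith
  qed simp
qed

lemma ret_iter_fixed: "y > 0 \<Longrightarrow> h y = 0 \<Longrightarrow> (ret ^^ n) y = y"
  by (induction n) (simp_all add: ret_sign(3))

lemma periodic_shift:
  fixes X :: "real \<Rightarrow> real^2"
  assumes "\<forall>t. X (t + T) = X t" shows "X (t + real n * T) = X t"
proof (induction n)
  case (Suc n)
  have "X (t + real (Suc n) * T) = X (t + real n * T + T)" by (simp add: algebra_simps)
  then show ?case using assms Suc by simp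
qed simp

text \<open>One period later the solution is back at \<open>cp y\<close>, where \<open>W\<close> is
  \<open>B y\<close>; but during the turn in progress \<open>W\<close> is \<open>A\<close> of an
  iterate of \<open>ret\<close>. If \<open>h y > 0\<close>, the iterates are at most
  \<open>y\<close> and \<open>A y < B y\<close>; if \<open>h y < 0\<close>, both inequalities are
  reversed. Either way the two values of \<open>W\<close> differ.\<close>

lemma periodic_imp_h_0:
  assumes per: "periodic_solution \<gamma> h X" and X0: "X t0 = cp y" "y > 0"
  shows "h y = 0" "range X = ring (A y)"
proof -
  obtain T where T: "T > 0" "\<forall>t. X (t + T) = X t" and sol: "solution_on \<gamma> h UNIV X"
    using per by (auto simp: periodic_solution_def)
  have I: "{t0..} \<subseteq> interior UNIV" by simp
  obtain t where "visits X t0 y t" by (rule orbit_sequence[OF sol I X0])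
  note t = visitsD[OF this]
  have c: "pi / 2 - \<alpha> > 0" using alpha_bounds by simp
  have "X (t0 + T) = cp y" using T X0 by simp
  moreover obtain n where "t n < t0 + T" "t0 + T \<le> t (Suc n)"
    using interval_index[of t, OF t(1,2) c, of "t0 + T"] T by auto
  ultimately have n: "B y = A ((ret ^^ n) y)" using t(5)[of n "t0 + T"] W_cp X0 by metis
  show h: "h y = 0"
  proof (rule ccontr)
    assume "h y \<noteq> 0"
    then consider "h y > 0" | "h y < 0" by linarith
    then show False
    proof cases
      case 1
      have "A ((ret ^^ n) y) \<le> A y"
        using ret_iter_le(2)[OF X0(2) 1, of n] A_less_iff[OF X0(2) ret_iter_pos[OF X0(2)], of n] by linarith
      moreover have "A y < B y" using lev_less_iff(1)[OF X0(2)] 1 by (simp add: A_def B_def)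
      ultimately show False using n by simp
    next
      case 2
      have "A ((ret ^^ n) y) \<ge> A y"
        using ret_iter_ge(2)[OF X0(2) 2, of n] A_less_iff[OF ret_iter_pos[OF X0(2)] X0(2), of n] by linarith
      moreover have "A y > B y" using lev_less_iff(2)[OF X0(2)] 2 by (simp add: A_def B_def)
      ultimately show False using n by simp
    qed
  qed
  note t = t[unfolded ret_iter_fixed[OF X0(2) h]]
  show "range X = ring (A y)"
  proof
    show "ring (A y) \<subseteq> range X" using t(4)[of 0] by auto
    show "range X \<subseteq> ring (A y)"
    proof safe
      fix s
      \<comment> \<open>Times before \<open>t0\<close> are covered by adding enough whole
        periods.\<close>
      obtain N :: nat where "(t0 - s) / T < N" using reals_Archimedean2 by blast
      then have "s + N * T > t0" using T by (simp add: field_simps)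
      then obtain n where "t n < s + N * T" "s + N * T \<le> t (Suc n)"
        using interval_index[of t, OF t(1,2) c] by blast
      then have "X (s + N * T) \<in> X ` {t n..t (Suc n)}" by (intro imageI) auto
      then show "X s \<in> ring (A y)" using t(4) periodic_shift[OF T(2)] by simp
    qed
  qed
qed


section \<open>Continuity of the turns in their level\<close>

lemma tendsto_Th:
  assumes k: "is_zone k" shows "(Th k \<longlongrightarrow> Th k c) (at c)"
proof (rule order_tendstoI)
  \<comment> \<open>The sign of \<open>H\<close> at a fixed angle \<open>a\<close> tells on which
    side of \<open>a\<close> the root lies, and a strict sign survives a small change of
    level.\<close>
  have lim: "((\<lambda>v. H (sp k v a)) \<longlongrightarrow> H (sp k c a)) (at c)" for a
  proof -
    have "continuous_on UNIV (\<lambda>v. H (sp k v a))"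
      by (rule continuous_on_compose2[OF continuous_H]) (auto intro!: continuous_intros)
    then show ?thesis by (auto simp: continuous_on_def)
  qed
  show "\<forall>\<^sub>F v in at c. a < Th k v" if a: "a < Th k c" for a
  proof (cases "a \<le> - (pi / 2)")
    case True
    have "a < Th k v" for v using Th_root(1)[of k v] True by auto
    then show ?thesis by simp
  next
    case False
    then have b: "\<bar>a\<bar> \<le> pi / 2" using a Th_root(1)[of k c] by auto
    have "\<forall>\<^sub>F v in at c. H (sp k v a) > 0"
      using order_tendstoD(1)[OF lim] H_sp_upper(1)[OF k b a] by blast
    then show ?thesis
    proof eventually_elim
      case (elim v)
      then show ?case using H_sp_upper(2)[OF k b, of v] Th_root(2)[of k v]
        by (metis less_irrefl less_asym linorder_neqE_linordered_idom)
    qed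
  qed
  show "\<forall>\<^sub>F v in at c. Th k v < a" if a: "Th k c < a" for a
  proof (cases "a \<ge> pi / 2")
    case True
    have "Th k v < a" for v using Th_root(1)[of k v] True by auto
    then show ?thesis by simp
  next
    case False
    then have b: "\<bar>a\<bar> \<le> pi / 2" using a Th_root(1)[of k c] by auto
    have "\<forall>\<^sub>F v in at c. H (sp k v a) < 0"
      using order_tendstoD(2)[OF lim] H_sp_upper(2)[OF k b a] by blast
    then show ?thesis
    proof eventually_elim
      case (elim v)
      then show ?case using H_sp_upper(1)[OF k b, of v] Th_root(2)[of k v]
        by (metis less_irrefl less_asym linorder_neqE_linordered_idom)
    qed
  qed
qed

lemma tendsto_lo_hi:
  assumes k: "is_zone k"
  shows "(lo k \<longlongrightarrow> lo k c) (at c)" "(hi k \<longlongrightarrow> hi k c) (at c)"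
  using tendsto_Th[OF k, of c] unfolding lo_def[abs_def] hi_def[abs_def] by (cases "k < 0"; simp)+

lemma arc_nonempty [simp]: "arc k v \<noteq> {}"
  using lo_hi_bounds(4)[of k v] by (simp add: arc_def)

lemma compact_arc: "compact (arc k v)"
  unfolding arc_def by (intro compact_continuous_image continuous_intros compact_Icc)

text \<open>Uniform continuity of \<open>sp\<close> on a compact box, which contains all angle
  ranges for levels within 1 of \<open>c\<close>. The range itself moves with the level, so an angle
  of the nearby arc is first clamped to the range of \<open>c\<close>.\<close>

lemma arc_near:
  assumes k: "is_zone k" and "\<epsilon> > 0"
  shows "\<forall>\<^sub>F v in nhds c. \<forall>p\<in>arc k v. infdist p (arc k c) < \<epsilon>"
proof -
  let ?K = "{c - 1..c + 1} \<times> {- pi..pi}"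
  have "continuous_on ?K (\<lambda>z. sp k (fst z) (snd z))" by (intro continuous_intros)
  then have "uniformly_continuous_on ?K (\<lambda>z. sp k (fst z) (snd z))"
    by (rule compact_uniformly_continuous) (intro compact_Times compact_Icc)
  then obtain d where d: "d > 0" "\<And>z z'. z \<in> ?K \<Longrightarrow> z' \<in> ?K \<Longrightarrow> dist z' z < d \<Longrightarrow>
      dist (sp k (fst z') (snd z')) (sp k (fst z) (snd z)) < \<epsilon>"
    using \<open>\<epsilon> > 0\<close> unfolding uniformly_continuous_on_def by meson
  have "\<forall>\<^sub>F v in nhds c. dist v c < min (d / 2) 1 \<and> dist (lo k v) (lo k c) < d / 2 \<and> dist (hi k v) (hi k c) < d / 2"
  proof (intro eventually_conj)
    show "\<forall>\<^sub>F v in nhds c. dist v c < min (d / 2) 1"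
      unfolding eventually_nhds_metric using d(1) by (intro exI[of _ "min (d / 2) 1"]) auto
    show "\<forall>\<^sub>F v in nhds c. dist (lo k v) (lo k c) < d / 2"
      using tendstoD[OF tendsto_lo_hi(1)[OF k, of c], of "d / 2"] d(1) by (simp add: eventually_nhds_conv_at)
    show "\<forall>\<^sub>F v in nhds c. dist (hi k v) (hi k c) < d / 2"
      using tendstoD[OF tendsto_lo_hi(2)[OF k, of c], of "d / 2"] d(1) by (simp add: eventually_nhds_conv_at)
  qed
  then show ?thesis
  proof eventually_elim
    case (elim v)
    show ?case
    proof
      fix p assume "p \<in> arc k v"
      then obtain \<theta> where th: "lo k v \<le> \<theta>" "\<theta> \<le> hi k v" "p = sp k v \<theta>" by (auto simp: arc_def)
      define \<theta>' where "\<theta>' = max (lo k c) (min \<theta> (hi k c))"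
      have th': "lo k c \<le> \<theta>'" "\<theta>' \<le> hi k c" "\<bar>\<theta> - \<theta>'\<bar> < d / 2"
        using th(1,2) elim lo_hi_bounds(4)[of k c] d(1) unfolding \<theta>'_def dist_real_def
        by (smt (verit) max_def min_def)+
      have "dist (v, \<theta>) (c, \<theta>') \<le> \<bar>v - c\<bar> + \<bar>\<theta> - \<theta>'\<bar>"
        unfolding dist_Pair_Pair using sqrt_sum_squares_le_sum_abs[of "dist v c" "dist \<theta> \<theta>'"]
        by (simp add: dist_real_def)
      also have "\<dots> < d" using elim th' by (simp add: dist_real_def)
      finally have "dist (v, \<theta>) (c, \<theta>') < d" .
      moreover have "c - 1 \<le> v" "v \<le> c + 1" using elim by (auto simp: dist_real_def)
      ultimately have "dist (sp k v \<theta>) (sp k c \<theta>') < \<epsilon>"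
        using d(2)[of "(c, \<theta>')" "(v, \<theta>)"] th th' elim lo_hi_bounds[of k c] lo_hi_bounds[of k v]
        by auto
      moreover have "sp k c \<theta>' \<in> arc k c" using th' by (auto simp: arc_def)
      ultimately show "infdist p (arc k c) < \<epsilon>"
        using infdist_le th(3) by (metis le_less_trans)
    qed
  qed
qed

lemma ring_near:
  assumes "\<epsilon> > 0"
  shows "\<forall>\<^sub>F v in nhds c. \<forall>p\<in>ring v. infdist p (ring c) < \<epsilon>"
proof -
  have "infdist p (ring c) \<le> infdist p (arc k c)" if "is_zone k" for p k
    using that by (intro infdist_mono) (auto simp: ring_def is_zone_def)
  then have le: "infdist p (ring c) < \<epsilon>" if "is_zone k" "infdist p (arc k c) < \<epsilon>" for p k
    using that by (meson le_less_trans)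
  have "\<forall>\<^sub>F v in nhds c. \<forall>p\<in>arc (- \<gamma>) v. infdist p (arc (- \<gamma>) c) < \<epsilon>"
    "\<forall>\<^sub>F v in nhds c. \<forall>p\<in>arc \<gamma> v. infdist p (arc \<gamma> c) < \<epsilon>"
    using assms by (intro arc_near; simp)+
  then show ?thesis
  proof eventually_elim
    case (elim v)
    show ?case
    proof
      fix p assume "p \<in> ring v"
      then have "p \<in> arc (- \<gamma>) v \<or> p \<in> arc \<gamma> v" by (simp add: ring_def)
      then show "infdist p (ring c) < \<epsilon>"
        using elim le[of "- \<gamma>" p] le[of \<gamma> p] by auto
    qed
  qed
qed

lemma isCont_lev:
  assumes "\<bar>\<theta>\<bar> < pi" shows "isCont (lev k) (sp k v \<theta>)"
proof -
  have "Zc k (sp k v \<theta>) \<notin> \<real>\<^sub>\<le>\<^sub>0"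
  proof
    assume neg: "Zc k (sp k v \<theta>) \<in> \<real>\<^sub>\<le>\<^sub>0"
    moreover have "Zc k (sp k v \<theta>) \<noteq> 0" by (simp add: Zc_0_iff)
    ultimately have "Im (Ln (Zc k (sp k v \<theta>))) = pi"
      by (simp add: Im_Ln_eq_pi complex_nonpos_Reals_iff complex_eq_iff less_le)
    then show False using lev_ang_sp(2)[of \<theta> k v] assms by (auto simp: ang_def abs_less_iff)
  qed
  then have "isCont (\<lambda>p. Ln (Zc k p)) (sp k v \<theta>)"
    by (intro isCont_Ln' linear_continuous_at[OF bounded_linear_Zc])
  then show ?thesis
    unfolding lev_def[abs_def] ang_def
    by (intro continuous_diff continuous_mult_left continuous_Re continuous_Im)
qed

lemma compact_ring: "compact (ring c)"
  unfolding ring_def by (intro compact_Un compact_arc)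

lemma ring_nonempty [simp]: "ring c \<noteq> {}"
  by (simp add: ring_def)

text \<open>\<open>W\<close> generally jumps across the upper switching curve. On this ring it does
  not, because \<open>h y = 0\<close> gives \<open>A y = B y\<close>: near a boundary point both the
  left and the right level are close to this common value, whichever of them \<open>W\<close>
  selects.\<close>

lemma W_near_point:
  assumes y: "y > 0" "h y = 0" and p: "p \<in> ring (A y)" and "\<delta> > 0"
  shows "\<forall>\<^sub>F q in nhds p. q \<noteq> 0 \<and> \<bar>W q - A y\<bar> < \<delta>"
proof -
  define c where "c = A y"
  have cB: "c = B y" using lev_eq_iff[OF y(1)] y(2) by (simp add: c_def A_def B_def)
  have L: "\<forall>\<^sub>F q in nhds (sp k c \<theta>). \<bar>lev k q - c\<bar> < \<delta>" if "\<bar>\<theta>\<bar> < pi" for k \<theta>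
  proof -
    have "(lev k \<longlongrightarrow> lev k (sp k c \<theta>)) (nhds (sp k c \<theta>))"
      using isCont_lev[OF that] by (simp add: isCont_def tendsto_at_iff_tendsto_nhds)
    moreover have "lev k (sp k c \<theta>) = c" using that by (intro lev_ang_sp) auto
    ultimately show ?thesis using tendstoD[of "lev k" c _ \<delta>] \<open>\<delta> > 0\<close> by (simp add: dist_real_def)
  qed
  obtain k \<theta> where k: "is_zone k" and th: "lo k c \<le> \<theta>" "\<theta> \<le> hi k c" "p = sp k c \<theta>"
  proof -
    have "p \<in> arc (- \<gamma>) c \<or> p \<in> arc \<gamma> c" using p by (simp add: ring_def c_def)
    then show ?thesis using that[of "- \<gamma>"] that[of \<gamma>] unfolding arc_def by auto
  qed
  have b: "\<bar>\<theta>\<bar> < pi" "\<bar>\<theta>\<bar> \<le> pi" using th lo_hi_bounds[of k c] by auto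
  have "p \<noteq> 0" using th by simp
  then have nz: "\<forall>\<^sub>F q in nhds p. q \<noteq> 0" by (simp add: t1_space_nhds)
  have "\<forall>\<^sub>F q in nhds p. \<bar>W q - c\<bar> < \<delta>"
  proof (cases "H p = 0")
    case False
    then have "k * H p > 0" using zone_sign[OF k b(2), of c] th by (metis le_less)
    moreover have "((\<lambda>q. k * H q) \<longlongrightarrow> k * H p) (nhds p)"
      using continuous_H by (intro tendsto_mult_left)
        (auto simp: continuous_on_def tendsto_at_iff_tendsto_nhds)
    ultimately have "\<forall>\<^sub>F q in nhds p. k * H q > 0" using order_tendstoD(1) by blast
    with L[OF b(1), of k] show ?thesis unfolding th(3)
    proof eventually_elim
      case (elim q)
      then show ?case using k gpos by (auto simp: W_def is_zone_def zero_less_mult_iff)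
    qed
  next
    case True
    then have bd: "\<theta> = lo k c \<or> \<theta> = hi k c" using zone_sign(2)[OF k b(2), of c] th by simp
    have curve: "sp j c (Th j c) = cp y" if "is_zone j" for j
      using that sp_Th[of j c] Yh_lev[OF that y(1)] cB by (auto simp: c_def A_def B_def is_zone_def)
    \<comment> \<open>A boundary point of the ring is a spiral point of level \<open>c\<close> in
      both coordinates: either \<open>cp y\<close> or the point on the negative y-axis.\<close>
    have "\<exists>\<theta>1 \<theta>2. \<bar>\<theta>1\<bar> < pi \<and> \<bar>\<theta>2\<bar> < pi \<and> p = sp (- \<gamma>) c \<theta>1 \<and> p = sp \<gamma> c \<theta>2"
    proof (cases "\<bar>\<theta>\<bar> < pi / 2")
      case True
      then have "\<theta> = Th k c" using bd k alpha_bounds by (auto simp: is_zone_def)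
      then have "p = cp y" using curve k th by simp
      then show ?thesis using curve[of \<gamma>] curve[of "- \<gamma>"] Th_root(1)[of \<gamma> c] Th_root(1)[of "- \<gamma>" c]
        by (intro exI[of _ "Th (- \<gamma>) c"] exI[of _ "Th \<gamma> c"]) auto
    next
      case False
      then have "p = sp \<gamma> c (\<alpha> - pi)" using bd k th Th_root(1)[of k c] sp_axis[of c] by (auto simp: is_zone_def)
      then show ?thesis using alpha_bounds sp_axis[of c]
        by (intro exI[of _ "pi - \<alpha>"] exI[of _ "\<alpha> - pi"]) auto
    qed
    then obtain \<theta>1 \<theta>2 where *: "\<bar>\<theta>1\<bar> < pi" "\<bar>\<theta>2\<bar> < pi" "p = sp (- \<gamma>) c \<theta>1" "p = sp \<gamma> c \<theta>2" by blast
    have "\<forall>\<^sub>F q in nhds p. \<bar>lev (- \<gamma>) q - c\<bar> < \<delta> \<and> \<bar>lev \<gamma> q - c\<bar> < \<delta>"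
      using L[OF *(1), of "- \<gamma>"] L[OF *(2), of \<gamma>] unfolding *(3,4)[symmetric] by (rule eventually_conj)
    then show ?thesis by eventually_elim (auto simp: W_def)
  qed
  with nz show ?thesis unfolding c_def by (rule eventually_conj)
qed

text \<open>Compactness of the ring turns the pointwise neighbourhoods into a tube of uniform
  width.\<close>

lemma W_near:
  assumes y: "y > 0" "h y = 0" and "\<delta> > 0"
  obtains \<epsilon> where "\<epsilon> > 0" "\<And>p. infdist p (ring (A y)) < \<epsilon> \<Longrightarrow> p \<noteq> 0 \<and> \<bar>W p - A y\<bar> < \<delta>"
proof -
  let ?N = "interior {q. q \<noteq> 0 \<and> \<bar>W q - A y\<bar> < \<delta>}"
  have "ring (A y) \<subseteq> ?N"
  proof
    fix p assume "p \<in> ring (A y)"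
    from W_near_point[OF y this \<open>\<delta> > 0\<close>] show "p \<in> ?N"
      by (auto simp: eventually_nhds interior_def)
  qed
  from compact_in_open_separated[OF ring_nonempty compact_ring open_interior this]
  obtain e where e: "e > 0" "{x. infdist x (ring (A y)) \<le> e} \<subseteq> ?N" by blast
  show ?thesis
  proof (rule that[OF e(1)])
    fix p assume "infdist p (ring (A y)) < e"
    then have "p \<in> ?N" using e(2) by auto
    then show "p \<noteq> 0 \<and> \<bar>W p - A y\<bar> < \<delta>" using interior_subset by blast
  qed
qed

text \<open>Continuity of the inverse of the increasing function \<open>B\<close>, by squeezing
  between its values at \<open>y - e\<close> and \<open>y + e\<close>. The bound
  \<open>y / 2\<close> keeps \<open>y - e\<close> positive.\<close>

lemma Yh_near:
  assumes "y > 0" "\<eta> > 0"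
  obtains \<delta> where "\<delta> > 0" "\<And>w. \<bar>w - B y\<bar> < \<delta> \<Longrightarrow> \<bar>Yh \<gamma> w - y\<bar> < \<eta>"
proof -
  define e where "e = min \<eta> (y / 2)"
  have e: "e > 0" "e \<le> \<eta>" "y - e > 0" using assms by (auto simp: e_def)
  let ?d = "min (B (y + e) - B y) (B y - B (y - e))"
  show ?thesis
  proof (rule that[of ?d])
    show "?d > 0" using B_less_iff[of y "y + e"] B_less_iff[of "y - e" y] e assms by simp
    fix w assume "\<bar>w - B y\<bar> < ?d"
    then have w: "B (y - e) < B (Yh \<gamma> w)" "B (Yh \<gamma> w) < B (y + e)" by (auto simp: B_def lev_Yh)
    then have "y - e < Yh \<gamma> w" "Yh \<gamma> w < y + e"
      using B_less_iff[of "y - e" "Yh \<gamma> w"] B_less_iff[of "Yh \<gamma> w" "y + e"] e assms Yh_pos by auto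
    then show "\<bar>Yh \<gamma> w - y\<bar> < \<eta>" using e by auto
  qed
qed

lemma isCont_lev_cp:
  assumes "y > 0" shows "isCont (\<lambda>y. lev k (cp y)) y"
proof -
  have hc: "isCont h y"
  proof -
    have "continuous_on {0<..} h" by (rule continuous_on_subset[OF continuous_h]) auto
    then show ?thesis using assms by (auto simp: continuous_on_eq_continuous_at[OF open_greaterThan])
  qed
  have "isCont (\<lambda>y. ln y + slope_lev k (m * h y / y)) y"
    using assms DERIV_isCont[OF slope_lev_deriv]
    by (intro continuous_intros hc isCont_o2[OF _ DERIV_isCont[OF slope_lev_deriv]]) auto
  moreover have "\<forall>\<^sub>F z in nhds y. lev k (cp z) = ln z + slope_lev k (m * h z / z)"
    using eventually_nhds_in_open[of "{0<..}" y] assms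
    by (auto elim!: eventually_mono simp: lev_upper)
  ultimately show ?thesis by (subst isCont_cong)
qed

section \<open>Isolation and asymptotic stability\<close>

lemma h_nonzero_near:
  assumes "y > 0" "h y = 0" "h' y \<noteq> 0"
  obtains \<eta> where "\<eta> > 0" "\<And>z. \<bar>z - y\<bar> < \<eta> \<Longrightarrow> z \<noteq> y \<Longrightarrow> sgn (h z) = sgn (h' y) * sgn (z - y)"
proof -
  have hd: "(h has_real_derivative h' y) (at y)"
    using h_deriv[of y] assms(1) at_within_interior[of y "{0..}"] by (simp add: interior_real_atLeast)
  have "\<exists>\<eta>>0. \<forall>z. \<bar>z - y\<bar> < \<eta> \<longrightarrow> z \<noteq> y \<longrightarrow> sgn (h z) = sgn (h' y) * sgn (z - y)"
  proof (cases "h' y > 0")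
    case True
    obtain d1 where d1: "d1 > 0" "\<And>x. x > 0 \<Longrightarrow> x < d1 \<Longrightarrow> h y < h (y + x)"
      using DERIV_pos_inc_right[OF hd True] by blast
    obtain d2 where d2: "d2 > 0" "\<And>x. x > 0 \<Longrightarrow> x < d2 \<Longrightarrow> h (y - x) < h y"
      using DERIV_pos_inc_left[OF hd True] by blast
    show ?thesis
    proof (intro exI[of _ "min d1 d2"] conjI allI impI)
      fix z assume "\<bar>z - y\<bar> < min d1 d2" "z \<noteq> y"
      then show "sgn (h z) = sgn (h' y) * sgn (z - y)"
        using d1(2)[of "z - y"] d2(2)[of "y - z"] True assms
        by (cases z y rule: linorder_cases) auto
    qed (use d1 d2 in auto)
  next
    case False
    then have neg: "h' y < 0" using assms by simp
    obtain d1 where d1: "d1 > 0" "\<And>x. x > 0 \<Longrightarrow> x < d1 \<Longrightarrow> h y > h (y + x)"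
      using DERIV_neg_dec_right[OF hd neg] by blast
    obtain d2 where d2: "d2 > 0" "\<And>x. x > 0 \<Longrightarrow> x < d2 \<Longrightarrow> h (y - x) > h y"
      using DERIV_neg_dec_left[OF hd neg] by blast
    show ?thesis
    proof (intro exI[of _ "min d1 d2"] conjI allI impI)
      fix z assume "\<bar>z - y\<bar> < min d1 d2" "z \<noteq> y"
      then show "sgn (h z) = sgn (h' y) * sgn (z - y)"
        using d1(2)[of "z - y"] d2(2)[of "y - z"] neg assms
        by (cases z y rule: linorder_cases) auto
    qed (use d1 d2 in auto)
  qed
  then show ?thesis using that by blast
qed

text \<open>A periodic solution that comes near the ring next reaches the curve at a height near
  \<open>y\<close>. There \<open>h\<close> must vanish, and \<open>h' y \<noteq> 0\<close> makes
  \<open>y\<close> the only such height.\<close>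

lemma limit_cycle_ring:
  assumes y: "y > 0" "h y = 0" "h' y \<noteq> 0" and orbit: "periodic_orbit \<gamma> h (ring (A y))"
  shows "limit_cycle \<gamma> h (ring (A y))"
proof -
  have cB: "A y = B y" using lev_eq_iff[OF y(1)] y(2) by (simp add: A_def B_def)
  obtain \<eta> where \<eta>: "\<eta> > 0" "\<And>z. \<bar>z - y\<bar> < \<eta> \<Longrightarrow> z \<noteq> y \<Longrightarrow> sgn (h z) = sgn (h' y) * sgn (z - y)"
    using h_nonzero_near[OF y] by blast
  obtain \<delta> where \<delta>: "\<delta> > 0" "\<And>w. \<bar>w - B y\<bar> < \<delta> \<Longrightarrow> \<bar>Yh \<gamma> w - y\<bar> < \<eta>"
    using Yh_near[OF y(1) \<eta>(1)] by blast
  obtain \<epsilon> where \<epsilon>: "\<epsilon> > 0" "\<And>p. infdist p (ring (A y)) < \<epsilon> \<Longrightarrow> p \<noteq> 0 \<and> \<bar>W p - A y\<bar> < \<delta>"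
    using W_near[OF y(1,2) \<delta>(1)] by blast
  have key: "range X = ring (A y)"
    if per: "periodic_solution \<gamma> h X" and near: "infdist (X t0) (ring (A y)) < \<epsilon>" for X t0
  proof -
    have sol: "solution_on \<gamma> h UNIV X" using per by (simp add: periodic_solution_def)
    define z where "z = Yh \<gamma> (W (X t0))"
    obtain t1 where "X t1 = cp z"
      using reach[OF sol, of t0] \<epsilon>(2)[OF near] by (auto simp: z_def)
    then have z: "h z = 0" "range X = ring (A z)"
      using periodic_imp_h_0[OF per, of t1 z] Yh_pos by (auto simp: z_def)
    have "\<bar>z - y\<bar> < \<eta>" using \<delta>(2) \<epsilon>(2)[OF near] cB by (simp add: z_def)
    then have "z = y" using \<eta>(2)[of z] z(1) y(3) by (auto simp: sgn_0_0 sgn_mult)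
    then show ?thesis using z by simp
  qed
  show ?thesis
    unfolding limit_cycle_def
  proof (intro conjI orbit exI[of _ \<epsilon>] \<epsilon>(1) allI impI)
    fix \<Gamma> assume *: "periodic_orbit \<gamma> h \<Gamma> \<and> (\<exists>p\<in>\<Gamma>. infdist p (ring (A y)) < \<epsilon>)"
    then obtain X where X: "periodic_solution \<gamma> h X" "\<Gamma> = range X"
      unfolding periodic_orbit_def by blast
    then obtain t0 where "infdist (X t0) (ring (A y)) < \<epsilon>" using * by blast
    then show "\<Gamma> = ring (A y)" using key[OF X(1)] X(2) by simp
  qed
qed

text \<open>Monotonicity of \<open>ret\<close> keeps the iterates on one side of the fixed point
  \<open>y\<close>, and they move towards it, so they converge. Passing to the limit in
  \<open>B (ret y) = A y\<close> along the iterates gives \<open>A L = B L\<close>, hence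
  \<open>h L = 0\<close> and \<open>L = y\<close>.\<close>

lemma ret_iter_tendsto:
  assumes y: "y > 0" "h y = 0"
    and sgn: "\<And>z. \<bar>z - y\<bar> < \<eta> \<Longrightarrow> z \<noteq> y \<Longrightarrow> sgn (h z) = sgn (z - y)"
    and z: "z > 0" "\<bar>z - y\<bar> < \<eta>"
  shows "(\<lambda>n. (ret ^^ n) z) \<longlonglongrightarrow> y"
proof -
  have fixed: "L = y" if L: "(\<lambda>n. (ret ^^ n) z) \<longlonglongrightarrow> L" "L > 0" "\<bar>L - y\<bar> < \<eta>" for L
  proof -
    have "(\<lambda>n. A ((ret ^^ n) z)) \<longlonglongrightarrow> A L"
      unfolding A_def by (rule isCont_tendsto_compose[OF isCont_lev_cp[OF L(2)] L(1)])
    moreover have "(\<lambda>n. B ((ret ^^ Suc n) z)) \<longlonglongrightarrow> B L"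
      unfolding B_def by (rule isCont_tendsto_compose[OF isCont_lev_cp[OF L(2)] LIMSEQ_Suc[OF L(1)]])
    ultimately have "A L = B L" by (simp add: B_ret LIMSEQ_unique)
    then have "h L = 0" using lev_eq_iff[OF L(2)] by (simp add: A_def B_def)
    then show ?thesis using sgn[OF L(3)] by (auto simp: sgn_0_0)
  qed
  consider "z = y" | "z > y" | "z < y" by linarith
  then show ?thesis
  proof cases
    case 1
    then show ?thesis using ret_iter_fixed[OF y] by simp
  next
    case 2
    then have hz: "h z > 0" using sgn[OF z(2)] by (simp add: sgn_if split: if_splits)
    have ge: "y < (ret ^^ n) z" for n
    proof (induction n)
      case (Suc n)
      then show ?case using ret_mono[OF y(1) Suc] ret_sign(3)[OF y] by simp
    qed (use 2 in simp)
    have "decseq (\<lambda>n. (ret ^^ n) z)"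
      using ret_iter_le(1)[OF z(1) hz] by (intro decseq_SucI less_imp_le)
    then obtain L where L: "(\<lambda>n. (ret ^^ n) z) \<longlonglongrightarrow> L" "\<And>n. L \<le> (ret ^^ n) z"
      using decseq_convergent[of "\<lambda>n. (ret ^^ n) z" y] less_imp_le[OF ge] by blast
    have "L \<ge> y" using LIMSEQ_le_const[OF L(1)] less_imp_le[OF ge] by blast
    then have "L = y" using fixed[OF L(1)] L(2)[of 0] z y 2 by simp
    then show ?thesis using L by simp
  next
    case 3
    then have hz: "h z < 0" using sgn[OF z(2)] by (simp add: sgn_if split: if_splits)
    have le: "(ret ^^ n) z < y" for n
    proof (induction n)
      case (Suc n)
      then show ?case using ret_mono[OF ret_iter_pos[OF z(1)] Suc] ret_sign(3)[OF y] by simp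
    qed (use 3 in simp)
    have "incseq (\<lambda>n. (ret ^^ n) z)"
      using ret_iter_ge(1)[OF z(1) hz] by (intro incseq_SucI less_imp_le)
    then obtain L where L: "(\<lambda>n. (ret ^^ n) z) \<longlonglongrightarrow> L" "\<And>n. L \<ge> (ret ^^ n) z"
      using incseq_convergent[of "\<lambda>n. (ret ^^ n) z" y] less_imp_le[OF le] by blast
    have "L \<le> y" using LIMSEQ_le_const2[OF L(1)] less_imp_le[OF le] by blast
    then have "L = y" using fixed[OF L(1)] L(2)[of 0] z y 3 by simp
    then show ?thesis using L by simp
  qed
qed

text \<open>The levels of successive turns converge to \<open>A y\<close>, and turns of nearby level
  lie in a thin tube around the ring.\<close>

lemma stable_ring:
  assumes y: "y > 0" "h y = 0" "h' y > 0" and orbit: "periodic_orbit \<gamma> h (ring (A y))"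
  shows "stable_limit_cycle \<gamma> h (ring (A y))"
proof -
  let ?\<Gamma> = "ring (A y)"
  have cB: "A y = B y" using lev_eq_iff[OF y(1)] y(2) by (simp add: A_def B_def)
  obtain \<eta> where \<eta>: "\<eta> > 0" "\<And>z. \<bar>z - y\<bar> < \<eta> \<Longrightarrow> z \<noteq> y \<Longrightarrow> sgn (h z) = sgn (z - y)"
    using h_nonzero_near[of y] y by auto
  obtain \<delta> where \<delta>: "\<delta> > 0" "\<And>w. \<bar>w - B y\<bar> < \<delta> \<Longrightarrow> \<bar>Yh \<gamma> w - y\<bar> < \<eta>"
    using Yh_near[OF y(1) \<eta>(1)] by blast
  obtain \<epsilon> where \<epsilon>: "\<epsilon> > 0" "\<And>p. infdist p ?\<Gamma> < \<epsilon> \<Longrightarrow> p \<noteq> 0 \<and> \<bar>W p - A y\<bar> < \<delta>"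
    using W_near[OF y(1,2) \<delta>(1)] by blast
  have "((\<lambda>t. infdist (X t) ?\<Gamma>) \<longlongrightarrow> 0) at_top"
    if sol: "solution_on \<gamma> h {0..} X" and near: "infdist (X 0) ?\<Gamma> < \<epsilon>" for X
  proof -
    \<comment> \<open>The solution condition applies only to interior times, so the argument starts
      at some \<open>t0 > 0\<close> at which the solution is still within \<epsilon> of the
      ring.\<close>
    have int: "interior {0 :: real..} = {0<..}" by (simp add: interior_real_atLeast)
    have "((\<lambda>t. infdist (X t) ?\<Gamma>) \<longlongrightarrow> infdist (X 0) ?\<Gamma>) (at 0 within {0..})"
      using sol by (intro tendsto_infdist) (auto simp: solution_on_def continuous_on_def)
    then have "\<forall>\<^sub>F t in at_right 0. infdist (X t) ?\<Gamma> < \<epsilon>"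
      using near by (intro order_tendstoD(2)[OF tendsto_within_subset]) auto
    then obtain t0 where t0: "t0 > 0" "infdist (X t0) ?\<Gamma> < \<epsilon>"
      unfolding eventually_at_right_field by (metis dense)
    have I0: "{t0..} \<subseteq> interior {0..}" using t0 by (auto simp: int)
    define z where "z = Yh \<gamma> (W (X t0))"
    obtain t1 where t1: "t1 \<ge> t0" "X t1 = cp z"
      using reach[OF sol I0] \<epsilon>(2)[OF t0(2)] by (auto simp: z_def)
    have I1: "{t1..} \<subseteq> interior {0..}" using t0 t1 by (auto simp: int)
    have z: "z > 0" "\<bar>z - y\<bar> < \<eta>"
      using \<delta>(2) \<epsilon>(2)[OF t0(2)] cB Yh_pos by (auto simp: z_def)
    obtain t where "visits X t1 z t" by (rule orbit_sequence[OF sol I1 t1(2) z(1)])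
    note t = visitsD[OF this]
    have sm: "strict_mono t" using t(3) by (simp add: strict_mono_Suc_iff)
    have lim: "(\<lambda>n. A ((ret ^^ n) z)) \<longlonglongrightarrow> A y"
      unfolding A_def
      by (rule isCont_tendsto_compose[OF isCont_lev_cp[OF y(1)] ret_iter_tendsto[OF y(1,2) \<eta>(2) z]])
    show ?thesis
    proof (rule tendstoI)
      fix e :: real assume "e > 0"
      have "\<forall>\<^sub>F n in sequentially. \<forall>p\<in>ring (A ((ret ^^ n) z)). infdist p ?\<Gamma> < e"
        using eventually_compose_filterlim[OF ring_near[OF \<open>e > 0\<close>] lim] .
      then obtain N where N: "\<And>n p. n \<ge> N \<Longrightarrow> p \<in> ring (A ((ret ^^ n) z)) \<Longrightarrow> infdist p ?\<Gamma> < e"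
        unfolding eventually_sequentially by blast
      have "infdist (X s) ?\<Gamma> < e" if s: "s > t N" for s
      proof -
        have "s > t1" using s t(1) sm by (metis le_less_trans strict_mono_less_eq zero_le)
        then obtain n where n: "t n < s" "s \<le> t (Suc n)"
          using interval_index[of t, OF t(1,2)] alpha_bounds by auto
        then have "t N < t (Suc n)" using s by simp
        then have "n \<ge> N" using sm by (simp add: strict_mono_less)
        moreover have "X s \<in> X ` {t n..t (Suc n)}" using n by (intro imageI) auto
        ultimately show ?thesis using N t(4) by blast
      qed
      then show "\<forall>\<^sub>F s in at_top. dist (infdist (X s) ?\<Gamma>) 0 < e"
        by (intro eventually_mono[OF eventually_gt_at_top[of "t N"]]) (simp add: infdist_nonneg)
    qed
  qed
  then show ?thesis unfolding stable_limit_cycle_def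
    using limit_cycle_ring[OF y(1,2) _ orbit] y(3) \<epsilon>(1) by auto
qed


section \<open>The explicit cycle\<close>

lemma has_vector_derivative_vec2:
  fixes f :: "real \<Rightarrow> real^2"
  assumes "((\<lambda>t. f t $ 1) has_real_derivative D $ 1) (at x)" "((\<lambda>t. f t $ 2) has_real_derivative D $ 2) (at x)"
  shows "(f has_vector_derivative D) (at x)"
proof -
  have eq: "p = p $ 1 *\<^sub>R axis 1 1 + p $ 2 *\<^sub>R axis 2 1" for p :: "real^2"
    by (simp add: vec2_eq_iff axis_def)
  have "((\<lambda>t. f t $ 1 *\<^sub>R axis 1 1 + f t $ 2 *\<^sub>R axis 2 1) has_vector_derivative
      (f x $ 1 *\<^sub>R 0 + D $ 1 *\<^sub>R axis 1 1) + (f x $ 2 *\<^sub>R 0 + D $ 2 *\<^sub>R (axis 2 1 :: real^2))) (at x)"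
    using has_vector_derivative_scaleR[OF assms(1), of "\<lambda>_. axis 1 1 :: real^2" 0]
      has_vector_derivative_scaleR[OF assms(2), of "\<lambda>_. axis 2 1 :: real^2" 0]
    by (intro has_vector_derivative_add) auto
  then show ?thesis by (simp flip: eq)
qed

text \<open>The converse of \<open>flow_segment\<close>, needed to certify the explicit cycle as a
  solution.\<close>

lemma sp_deriv:
  assumes k: "is_zone k"
  shows "((\<lambda>t. sp k v (a + t)) has_vector_derivative
    vector [2 * k * sp k v (a + t) $ 1 - sp k v (a + t) $ 2, m * sp k v (a + t) $ 1]) (at t)"
proof (rule has_vector_derivative_vec2)
  let ?e = "exp (v + k * (a + t))"
  have "((\<lambda>t. exp (v + k * (a + t)) * (k * cos (a + t) - sin (a + t))) has_real_derivative
      ?e * k * (k * cos (a + t) - sin (a + t)) + ?e * (- k * sin (a + t) - cos (a + t))) (at t)"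
    by (auto intro!: derivative_eq_intros simp: algebra_simps)
  from DERIV_cdivide[OF this, of m]
  have "((\<lambda>t. exp (v + k * (a + t)) * (k * cos (a + t) - sin (a + t)) / m) has_real_derivative
      (?e * k * (k * cos (a + t) - sin (a + t)) + ?e * (- k * sin (a + t) - cos (a + t))) / m) (at t)" .
  moreover have "(e * k * (k * c - s) + e * (- k * s - c)) / m = 2 * k * (e * (k * c - s) / m) - e * c" for e c s
  proof -
    have "e * k * (k * c - s) + e * (- k * s - c) = 2 * k * (e * (k * c - s)) - e * c * (k\<^sup>2 + 1)"
      by (simp add: algebra_simps power2_eq_square)
    also have "k\<^sup>2 + 1 = m" using is_zone_sq[OF k] by simp
    finally show ?thesis by (simp add: diff_divide_distrib)
  qed
  ultimately show "((\<lambda>t. sp k v (a + t) $ 1) has_real_derivative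
      (vector [2 * k * sp k v (a + t) $ 1 - sp k v (a + t) $ 2, m * sp k v (a + t) $ 1] :: real^2) $ 1) (at t)"
    by simp
  have "((\<lambda>t. exp (v + k * (a + t)) * cos (a + t)) has_real_derivative
      ?e * k * cos (a + t) + ?e * - sin (a + t)) (at t)"
    by (auto intro!: derivative_eq_intros simp: algebra_simps)
  moreover have "m * sp k v (a + t) $ 1 = ?e * (k * cos (a + t) - sin (a + t))" by simp
  then have "m * sp k v (a + t) $ 1 = ?e * k * cos (a + t) + ?e * - sin (a + t)"
    by (simp only: right_diff_distrib mult.assoc)
  ultimately show "((\<lambda>t. sp k v (a + t) $ 2) has_real_derivative
      (vector [2 * k * sp k v (a + t) $ 1 - sp k v (a + t) $ 2, m * sp k v (a + t) $ 1] :: real^2) $ 2) (at t)"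
    by (simp del: sp_nth(1) add: sp_nth(2))
qed

text \<open>The slope is 0, so the angle is the arctangent of \<open>k\<close>. Both arcs then span
  an angle of exactly \<open>pi\<close>, which gives the cycle its period
  \<open>2 * pi\<close>.\<close>

lemma Th_axis:
  assumes "y > 0" "h y = 0"
  shows "Th \<gamma> (A y) = \<alpha>" "Th (- \<gamma>) (A y) = - \<alpha>"
proof -
  have "A y = B y" using lev_eq_iff[OF assms(1)] assms(2) by (simp add: A_def B_def)
  then show "Th \<gamma> (A y) = \<alpha>"
    using assms by (simp add: B_def Th_lev ang_upper \<alpha>_def)
  show "Th (- \<gamma>) (A y) = - \<alpha>"
    using assms by (simp add: A_def Th_lev ang_upper \<alpha>_def arctan_minus)
qed

lemma sp_curve:
  assumes "y > 0" "h y = 0"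
  shows "sp \<gamma> (A y) \<alpha> = cp y" "sp (- \<gamma>) (A y) (- \<alpha>) = cp y"
proof -
  have "A y = B y" using lev_eq_iff[OF assms(1)] assms(2) by (simp add: A_def B_def)
  then show "sp \<gamma> (A y) \<alpha> = cp y" "sp (- \<gamma>) (A y) (- \<alpha>) = cp y"
    using sp_Th[of \<gamma> "A y"] sp_Th[of "- \<gamma>" "A y"] Th_axis[OF assms] Yh_B[OF assms(1)] Yh_lev[of "- \<gamma>" y] assms(1)
    by (auto simp: A_def)
qed

lemma axis_trig:
  "\<gamma> * cos \<theta> - sin \<theta> = sin (\<alpha> - \<theta>) / cos \<alpha>"
  "- \<gamma> * cos \<theta> - sin \<theta> = - sin (\<alpha> + \<theta>) / cos \<alpha>"
  using cos_alpha_pos by (simp_all add: sin_diff sin_add sin_alpha field_simps)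

text \<open>Since \<open>arccos (cos t) = \<bar>t\<bar>\<close> on \<open>{- pi..pi}\<close>, this is the \<open>2 * pi\<close>-periodic curve that follows the right
  spiral of level \<open>c\<close> on \<open>{- pi..0}\<close> and the left one on \<open>{0..pi}\<close>.\<close>

definition cycle :: "real \<Rightarrow> real \<Rightarrow> real^2" where
  "cycle c t = (let e = exp (c + \<gamma> * \<alpha> - \<gamma> * arccos (cos t)) in
    vector [e * (- sin t) / (m * cos \<alpha>), e * (cos t * cos \<alpha> + \<bar>sin t\<bar> * sin \<alpha>)])"

lemma cycle_periodic: "cycle c (t + 2 * pi * of_int n) = cycle c t"
  using sin_int_2pin[of n] cos_int_2pin[of n]
  by (simp add: cycle_def Let_def sin_add cos_add mult.commute mult.left_commute)

lemma cycle_left: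
  assumes "2 * pi * of_int n \<le> t" "t \<le> 2 * pi * of_int n + pi"
  shows "cycle c t = sp (- \<gamma>) c (- \<alpha> + (t - 2 * pi * of_int n))"
proof -
  define s where "s = t - 2 * pi * of_int n"
  have s: "0 \<le> s" "s \<le> pi" using assms by (auto simp: s_def)
  have "cycle c t = cycle c s" using cycle_periodic[of c s n] by (simp add: s_def)
  also have "\<dots> = sp (- \<gamma>) c (- \<alpha> + s)"
  proof -
    have e: "c + \<gamma> * \<alpha> - \<gamma> * arccos (cos s) = c + - \<gamma> * (- \<alpha> + s)"
      using s by (simp add: arccos_cos algebra_simps)
    have x: "- \<gamma> * cos (- \<alpha> + s) - sin (- \<alpha> + s) = - sin s / cos \<alpha>"
      unfolding axis_trig(2) by simp
    have y: "cos s * cos \<alpha> + \<bar>sin s\<bar> * sin \<alpha> = cos (- \<alpha> + s)"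
      using sin_ge_zero[OF s] by (simp add: cos_diff)
    show ?thesis unfolding cycle_def sp_def Let_def e x y by (simp add: vec2_eq_iff mult.commute)
  qed
  finally show ?thesis by (simp add: s_def)
qed

lemma cycle_right:
  assumes "2 * pi * of_int n - pi \<le> t" "t \<le> 2 * pi * of_int n"
  shows "cycle c t = sp \<gamma> c (\<alpha> + (t - 2 * pi * of_int n))"
proof -
  define s where "s = t - 2 * pi * of_int n"
  have s: "- pi \<le> s" "s \<le> 0" using assms by (auto simp: s_def)
  have "cycle c t = cycle c s" using cycle_periodic[of c s n] by (simp add: s_def)
  also have "\<dots> = sp \<gamma> c (\<alpha> + s)"
  proof -
    have e: "c + \<gamma> * \<alpha> - \<gamma> * arccos (cos s) = c + \<gamma> * (\<alpha> + s)"
      using s arccos_cos[of "- s"] by (simp add: algebra_simps)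
    have x: "\<gamma> * cos (\<alpha> + s) - sin (\<alpha> + s) = - sin s / cos \<alpha>"
      unfolding axis_trig(1) by simp
    have y: "cos s * cos \<alpha> + \<bar>sin s\<bar> * sin \<alpha> = cos (\<alpha> + s)"
      using sin_ge_zero[of "- s"] s by (simp add: cos_add)
    show ?thesis unfolding cycle_def sp_def Let_def e x y by (simp add: vec2_eq_iff mult.commute)
  qed
  finally show ?thesis by (simp add: s_def)
qed

lemma continuous_cycle: "continuous_on UNIV (cycle c)"
  by (rule continuous_on_vec2) (auto simp: cycle_def Let_def cos_alpha_pos[THEN less_imp_neq, symmetric] intro!: continuous_intros)

lemma cycle_solution:
  assumes y: "y > 0" "h y = 0"
  shows "periodic_solution \<gamma> h (cycle (A y))" "cycle (A y) 0 = cp y"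
proof -
  define c where "c = A y"
  note Th = Th_axis[OF y, folded c_def]
  define N where "N n = 2 * pi * of_int n" for n :: int
  note left = cycle_left[of _ _ c, folded N_def] and right = cycle_right[of _ _ c, folded N_def]
  have left_H: "H (cycle c t) < 0" if "N n < t" "t < N n + pi" for t n
  proof -
    have "(- \<gamma>) * H (sp (- \<gamma>) c (- \<alpha> + (t - N n))) > 0"
      by (subst zone_sign(1)) (use that alpha_bounds Th in auto)
    then show ?thesis using left[of n t] that gpos by (simp add: mult_less_0_iff)
  qed
  have right_H: "H (cycle c t) > 0" if "N n - pi < t" "t < N n" for t n
  proof -
    have "\<gamma> * H (sp \<gamma> c (\<alpha> + (t - N n))) > 0"
      by (subst zone_sign(1)) (use that alpha_bounds Th in auto)
    then show ?thesis using right[of n t] that gpos by (simp add: zero_less_mult_iff)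
  qed
  have deriv: "(cycle c has_vector_derivative pw_field \<gamma> h (cycle c t)) (at t)"
    if k: "is_zone k" and pos: "k * H (cycle c t) > 0"
      and eq: "\<And>s. l < s \<Longrightarrow> s < u \<Longrightarrow> cycle c s = sp k c (a + s)" and t: "l < t" "t < u" for k l u a t
  proof -
    have "(cycle c has_vector_derivative vector [2 * k * cycle c t $ 1 - cycle c t $ 2, m * cycle c t $ 1]) (at t)"
      unfolding eq[OF t]
      by (rule has_vector_derivative_transform_within_open[OF sp_deriv[OF k], of "{l<..<u}"])
        (use t eq in auto)
    then show ?thesis using pw_field_zone[OF k pos] by simp
  qed
  have step: "if H (cycle c t) = 0 \<and> cycle c t \<noteq> 0 then crosses_at h (cycle c) t
      else (cycle c has_vector_derivative pw_field \<gamma> h (cycle c t)) (at t)" for t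
  proof -
    \<comment> \<open>The ceiling places \<open>t\<close> in a window that is open at
      \<open>N n - pi\<close> and closed at \<open>N n + pi\<close>, so the lower crossing occurs
      only as its right end.\<close>
    define n where "n = \<lceil>(t - pi) / (2 * pi)\<rceil>"
    have "of_int n - 1 < (t - pi) / (2 * pi)" "(t - pi) / (2 * pi) \<le> of_int n"
      unfolding n_def by linarith+
    then have n: "N n - pi < t" "t \<le> N n + pi" 
      by (simp_all add: N_def field_simps)
    consider "N n - pi < t" "t < N n" | "t = N n" | "N n < t" "t < N n + pi" | "t = N n + pi"
      using n by linarith
    then show ?thesis
    proof cases
      case 1
      have "(cycle c has_vector_derivative pw_field \<gamma> h (cycle c t)) (at t)"
        using right_H[OF 1] gpos right 1
        by (intro deriv[of \<gamma> t "N n - pi" "N n" "\<alpha> - N n"]) (auto simp: algebra_simps)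
      then show ?thesis using right_H[OF 1] by simp
    next
      case 3
      have "(cycle c has_vector_derivative pw_field \<gamma> h (cycle c t)) (at t)"
        using left_H[OF 3] gpos left 3
        by (intro deriv[of "- \<gamma>" t "N n" "N n + pi" "- \<alpha> - N n"]) (auto simp: algebra_simps mult_pos_neg)
      then show ?thesis using left_H[OF 3] by simp
    next
      case 2
      have "\<forall>\<^sub>F s in at_left t. H (cycle c s) > 0"
        using right_H[of n] 2 by (intro eventually_at_leftI[of "N n - pi"]) auto
      moreover have "\<forall>\<^sub>F s in at_right t. H (cycle c s) < 0"
        using left_H[of n] 2 by (intro eventually_at_rightI[of _ "N n + pi"]) auto
      moreover have "cycle c t = cp y" using left[of n t] 2 sp_curve[OF y] by (simp add: c_def)
      ultimately show ?thesis using y cp_nonzero by (simp add: crosses_at_def)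
    next
      case 4
      \<comment> \<open>Just after the lower crossing the solution is on the right arc of the next
        window.\<close>
      have N: "N (n + 1) = N n + 2 * pi" by (simp add: N_def algebra_simps)
      have "\<forall>\<^sub>F s in at_left t. H (cycle c s) < 0"
        using left_H[of n] 4 by (intro eventually_at_leftI[of "N n"]) auto
      moreover have "\<forall>\<^sub>F s in at_right t. H (cycle c s) > 0"
        using right_H[of "n + 1"] 4 N by (intro eventually_at_rightI[of _ "N n + 2 * pi"]) auto
      moreover have "cycle c t = sp (- \<gamma>) c (pi - \<alpha>)" using left[of n t] 4 by simp
      then have "cycle c t \<noteq> 0" "H (cycle c t) = 0"
        using zone_sign(2)[of "- \<gamma>" "pi - \<alpha>" c] alpha_bounds by auto
      ultimately show ?thesis by (simp add: crosses_at_def)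
    qed
  qed
  show c0: "cycle (A y) 0 = cp y"
    using left[of 0 0] sp_curve[OF y] by (simp add: c_def N_def)
  have "cycle c pi $ 2 < 0" using left[of 0 pi] cos_alpha_pos by (simp add: N_def cos_diff)
  then have "cycle c pi \<noteq> cycle c 0" using c0 y by (auto simp: c_def)
  then have "\<not> cycle c constant_on UNIV" by (metis UNIV_I constant_on_def)
  moreover have "\<exists>T>0. \<forall>t. cycle c (t + T) = cycle c t"
    using cycle_periodic[of c _ 1] by (intro exI[of _ "2 * pi"]) auto
  ultimately show "periodic_solution \<gamma> h (cycle (A y))"
    unfolding periodic_solution_def solution_on_def c_def[symmetric]
    using step continuous_cycle by auto
qed

lemma sin_zero_iff_ends: "0 \<le> x \<Longrightarrow> x \<le> pi \<Longrightarrow> sin x = 0 \<longleftrightarrow> x = 0 \<or> x = pi"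
  using sin_gt_zero[of x] by (cases "x = 0"; cases "x = pi") auto

text \<open>On either arc \<open>x\<close> is proportional to a shifted sine over an interval of
  length exactly \<open>pi\<close>, so it vanishes only at the ends. The factor
  \<open>exp (- \<gamma> * pi)\<close> is the contraction over the left half turn.\<close>

lemma ring_axis:
  assumes y: "y > 0" "h y = 0"
  shows "ring (A y) \<inter> {p. p $ 1 = 0} = {vector [0, y], vector [0, - exp (- \<gamma> * pi) * y]}"
proof -
  define c where "c = A y"
  note Th = Th_axis[OF y, folded c_def] and curve = sp_curve[OF y, folded c_def]
  have cp: "cp y = vector [0, y]" by (simp add: cp_def y)
  have "exp (c + \<gamma> * \<alpha>) * cos \<alpha> = y" using arg_cong[OF curve(1), of "\<lambda>p. p $ 2"] by simp
  moreover have "cos (pi - \<alpha>) = - cos \<alpha>" "sin (pi - \<alpha>) = sin \<alpha>" by (simp_all add: cos_diff sin_diff)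
  moreover have "exp (c - \<gamma> * (pi - \<alpha>)) = exp (c + \<gamma> * \<alpha>) * exp (- \<gamma> * pi)"
    by (simp add: algebra_simps flip: exp_add)
  ultimately have low: "sp (- \<gamma>) c (pi - \<alpha>) = vector [0, - exp (- \<gamma> * pi) * y]"
    by (simp add: vec2_eq_iff sin_alpha)
  have L: "sp (- \<gamma>) c \<theta> $ 1 = 0 \<longleftrightarrow> sin (\<alpha> + \<theta>) = 0" and R: "sp \<gamma> c \<theta> $ 1 = 0 \<longleftrightarrow> sin (\<alpha> - \<theta>) = 0" for \<theta>
    using cos_alpha_pos axis_trig[of \<theta>] by auto
  have "p = vector [0, y] \<or> p = vector [0, - exp (- \<gamma> * pi) * y]" if p: "p \<in> ring c" "p $ 1 = 0" for p
  proof -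
    consider \<theta> where "p = sp (- \<gamma>) c \<theta>" "- \<alpha> \<le> \<theta>" "\<theta> \<le> pi - \<alpha>"
      | \<theta> where "p = sp \<gamma> c \<theta>" "\<alpha> - pi \<le> \<theta>" "\<theta> \<le> \<alpha>"
      using p(1) unfolding ring_def arc_def lo_hi_gamma Th by auto
    then show ?thesis
    proof cases
      case 1
      then have "\<theta> = - \<alpha> \<or> \<theta> = pi - \<alpha>"
        using p(2) L[of \<theta>] sin_zero_iff_ends[of "\<alpha> + \<theta>"] by auto
      then show ?thesis using 1(1) low curve(2) cp by metis
    next
      case 2
      then have "\<theta> = \<alpha> \<or> \<theta> = \<alpha> - pi"
        using p(2) R[of \<theta>] sin_zero_iff_ends[of "\<alpha> - \<theta>"] by auto
      then show ?thesis using 2(1) low curve(1) cp sp_axis[of c] by metis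
    qed
  qed
  moreover have "sp \<gamma> c \<alpha> \<in> ring c" "sp (- \<gamma>) c (pi - \<alpha>) \<in> ring c"
    unfolding ring_def arc_def lo_hi_gamma Th using alpha_bounds by (auto simp del: sp_nth)
  ultimately show ?thesis unfolding c_def[symmetric] using low cp curve(1) by (auto simp del: sp_nth)
qed


section \<open>Arbitrary periodic solutions through the curve\<close>

lemma periodic_through_curve:
  assumes "periodic_solution \<gamma> h X" "cp y \<in> range X" "y > 0"
  shows "h y = 0" "range X = ring (A y)"
proof -
  obtain t0 where "X t0 = cp y" using assms(2) by auto
  from periodic_imp_h_0[OF assms(1) this assms(3)] show "h y = 0" "range X = ring (A y)" .
qed

lemma stable_through_curve:
  assumes "periodic_solution \<gamma> h X" "cp y \<in> range X" "y > 0" "h' y > 0"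
  shows "stable_limit_cycle \<gamma> h (range X)"
proof -
  note r = periodic_through_curve[OF assms(1-3)]
  have "periodic_orbit \<gamma> h (ring (A y))" using assms(1) r(2) by (auto simp: periodic_orbit_def)
  from stable_ring[OF assms(3) r(1) assms(4) this] show ?thesis by (simp add: r(2))
qed

lemma limit_cycle_through_curve:
  assumes "periodic_solution \<gamma> h X" "cp y \<in> range X" "y > 0" "h' y \<noteq> 0"
  shows "limit_cycle \<gamma> h (range X)"
proof -
  note r = periodic_through_curve[OF assms(1-3)]
  have "periodic_orbit \<gamma> h (ring (A y))" using assms(1) r(2) by (auto simp: periodic_orbit_def)
  from limit_cycle_ring[OF assms(3) r(1) assms(4) this] show ?thesis by (simp add: r(2))
qed

end

section \<open>Time reversal\<close>

definition mirror :: "real^2 \<Rightarrow> real^2" where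
  "mirror p = vector [- (p $ 1), p $ 2]"

lemma mirror_nth [simp]: "mirror p $ 1 = - (p $ 1)" "mirror p $ 2 = p $ 2"
  by (simp_all add: mirror_def)

lemma mirror_mirror [simp]: "mirror (mirror p) = p"
  by (simp add: vec_eq_iff forall_2)

lemma mirror_eq_0 [simp]: "mirror p = 0 \<longleftrightarrow> p = 0"
  by (simp add: vec_eq_iff forall_2)

lemma bounded_linear_mirror: "bounded_linear mirror"
  unfolding linear_conv_bounded_linear[symmetric]
  by (rule linearI) (auto simp: vec_eq_iff forall_2)

lemma dist_mirror [simp]: "dist (mirror p) (mirror q) = dist p q"
  by (simp add: dist_vec_def sum_2 L2_set_def dist_real_def power2_commute)

lemma infdist_mirror: "infdist (mirror p) (mirror ` S) = infdist p S"
  by (simp add: infdist_def image_image)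

lemma switch_fun_mirror: "switch_fun (\<lambda>y. - h y) (mirror p) = - switch_fun h p"
  by (simp add: switch_fun_def)

text \<open>The switching curve has to be excluded: there the field is that of the right zone by
  convention, which reflection does not respect. At the origin both fields vanish.\<close>

lemma pw_field_mirror:
  assumes "switch_fun h p \<noteq> 0 \<or> p = 0"
  shows "pw_field \<gamma> (\<lambda>y. - h y) (mirror p) = - mirror (pw_field \<gamma> h p)"
  using assms
  by (auto simp: pw_field_def switch_fun_mirror G_minus_def G_plus_def vec_eq_iff forall_2
      matrix_vector_mult_def sum_2)

text \<open>Time reversal exchanges the two sides of \<open>t\<close> and reflection changes the
  sign of the switching function, so the direction of crossing is preserved.\<close>

lemma crosses_at_mirror:
  assumes "crosses_at h X (- t)"
  shows "crosses_at (\<lambda>y. - h y) (\<lambda>t. mirror (X (- t))) t"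
proof -
  have "at_left t = filtermap uminus (at_right (- t))" "at_right t = filtermap uminus (at_left (- t))"
    using at_left_minus[of t] at_right_minus[of t] by auto
  then show ?thesis using assms
    by (auto simp: crosses_at_def eventually_filtermap switch_fun_mirror)
qed

text \<open>Reversing time and reflecting \<open>x\<close> exchanges the two zones and replaces \<open>h\<close> by \<open>- h\<close>.\<close>

lemma solution_on_mirror:
  assumes "solution_on \<gamma> h I X"
  shows "solution_on \<gamma> (\<lambda>y. - h y) (uminus ` I) (\<lambda>t. mirror (X (- t)))"
  unfolding solution_on_def
proof (intro conjI ballI)
  have "continuous_on I X" using assms by (simp add: solution_on_def)
  then have "continuous_on (uminus ` I) (\<lambda>t. X (- t))"
    by (rule continuous_on_compose2) (auto intro: continuous_intros)
  then show "continuous_on (uminus ` I) (\<lambda>t. mirror (X (- t)))"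
    by (rule bounded_linear.continuous_on[OF bounded_linear_mirror])
  fix t assume "t \<in> interior (uminus ` I)"
  then have t: "- t \<in> interior I" by (auto simp: interior_negations)
  then have step: "if switch_fun h (X (- t)) = 0 \<and> X (- t) \<noteq> 0 then crosses_at h X (- t)
      else (X has_vector_derivative pw_field \<gamma> h (X (- t))) (at (- t))"
    using assms by (simp add: solution_on_def)
  show "if switch_fun (\<lambda>y. - h y) (mirror (X (- t))) = 0 \<and> mirror (X (- t)) \<noteq> 0
      then crosses_at (\<lambda>y. - h y) (\<lambda>t. mirror (X (- t))) t
      else ((\<lambda>t. mirror (X (- t))) has_vector_derivative
        pw_field \<gamma> (\<lambda>y. - h y) (mirror (X (- t)))) (at t)"
  proof (cases "switch_fun h (X (- t)) = 0 \<and> X (- t) \<noteq> 0")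
    case True
    then show ?thesis using step crosses_at_mirror by (simp add: switch_fun_mirror)
  next
    case False
    then have "(X has_vector_derivative pw_field \<gamma> h (X (- t))) (at (- t))" using step by simp
    moreover have "(uminus has_vector_derivative - 1) (at t)"
      by (auto intro!: derivative_eq_intros)
    ultimately have "((X \<circ> uminus) has_vector_derivative - 1 *\<^sub>R pw_field \<gamma> h (X (- t))) (at t)"
      by (intro vector_diff_chain_at) auto
    then have "((\<lambda>t. mirror (X (- t))) has_vector_derivative mirror (- pw_field \<gamma> h (X (- t)))) (at t)"
      using bounded_linear.has_vector_derivative[OF bounded_linear_mirror] by (auto simp: o_def)
    moreover have "mirror (- p) = - mirror p" for p by (simp add: vec_eq_iff forall_2)
    ultimately show ?thesis using False pw_field_mirror[of h "X (- t)" \<gamma>]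
      by (auto simp: switch_fun_mirror)
  qed
qed

lemma periodic_solution_mirror:
  assumes "periodic_solution \<gamma> h X"
  shows "periodic_solution \<gamma> (\<lambda>y. - h y) (\<lambda>t. mirror (X (- t)))"
proof -
  obtain T where T: "T > 0" "\<And>t. X (t + T) = X t" using assms by (auto simp: periodic_solution_def)
  have "X (- (t + T)) = X (- t)" for t using T(2)[of "- (t + T)"] by simp
  moreover have "solution_on \<gamma> (\<lambda>y. - h y) UNIV (\<lambda>t. mirror (X (- t)))"
    using solution_on_mirror[of \<gamma> h UNIV X] assms by (simp add: periodic_solution_def)
  moreover have "\<not> (\<lambda>t. mirror (X (- t))) constant_on UNIV"
  proof
    assume "(\<lambda>t. mirror (X (- t))) constant_on UNIV"
    then obtain p where "\<And>t. mirror (X (- t)) = p" by (auto simp: constant_on_def)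
    then have "X t = mirror p" for t using mirror_mirror[of "X t"] by (metis minus_minus)
    then have "X constant_on UNIV" by (auto simp: constant_on_def)
    then show False using assms by (simp add: periodic_solution_def)
  qed
  ultimately show ?thesis using T(1) by (auto simp: periodic_solution_def)
qed

lemma range_mirror: "range (\<lambda>t. mirror (X (- t :: real))) = mirror ` range X"
proof -
  have "range (\<lambda>t. mirror (X (- t))) = (\<lambda>t. mirror (X t)) ` range (uminus :: real \<Rightarrow> real)"
    by (simp only: image_image)
  also have "\<dots> = mirror ` range X" by (simp only: surj_uminus image_image)
  finally show ?thesis .
qed

text \<open>Reflection is an isometry and time reversal exchanges the two ends of time, so the
  \<epsilon> of the mirrored cycle serves for the original one.\<close>

lemma unstable_of_mirror_stable:
  assumes lim: "limit_cycle \<gamma> h \<Gamma>" and st: "stable_limit_cycle \<gamma> (\<lambda>y. - h y) (mirror ` \<Gamma>)"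
  shows "unstable_limit_cycle \<gamma> h \<Gamma>"
proof -
  obtain \<epsilon> where \<epsilon>: "\<epsilon> > 0" "\<And>X. solution_on \<gamma> (\<lambda>y. - h y) {0..} X \<Longrightarrow> infdist (X 0) (mirror ` \<Gamma>) < \<epsilon> \<Longrightarrow>
      ((\<lambda>t. infdist (X t) (mirror ` \<Gamma>)) \<longlongrightarrow> 0) at_top"
    using st unfolding stable_limit_cycle_def by blast
  have "((\<lambda>t. infdist (X t) \<Gamma>) \<longlongrightarrow> 0) at_bot"
    if "solution_on \<gamma> h {..0} X" "infdist (X 0) \<Gamma> < \<epsilon>" for X
  proof -
    have "solution_on \<gamma> (\<lambda>y. - h y) {0..} (\<lambda>t. mirror (X (- t)))"
      using solution_on_mirror[OF that(1)] by simp
    from \<epsilon>(2)[OF this] that(2) have "((\<lambda>t. infdist (X (- t)) \<Gamma>) \<longlongrightarrow> 0) at_top"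
      by (simp add: infdist_mirror)
    then show ?thesis by (simp add: filterlim_at_bot_mirror)
  qed
  then show ?thesis using lim \<epsilon>(1) unfolding unstable_limit_cycle_def by blast
qed

theorem theorem2:
  fixes \<gamma> :: real and h h' :: "real \<Rightarrow> real" and ystar :: real
  assumes "\<gamma> > 0"
    and "\<And>y. y \<ge> 0 \<Longrightarrow> (h has_real_derivative h' y) (at y within {0..})"
    and "continuous_on {0..} h'"
    and "h 0 = 0"
    and "\<And>y. y > 0 \<Longrightarrow> \<bar>h y\<bar> < y / \<gamma>"
    and "\<And>y. y > 0 \<Longrightarrow> h y * (2 * \<gamma> - (1 + \<gamma>\<^sup>2) * h' y) < y"
    and "\<And>y. y > 0 \<Longrightarrow> h y * (2 * \<gamma> + (1 + \<gamma>\<^sup>2) * h' y) > - y"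
    and "ystar > 0"
  shows "((\<exists>X. periodic_solution \<gamma> h X \<and> vector [h ystar, ystar] \<in> range X) \<longleftrightarrow> h ystar = 0) \<and>
    (h ystar = 0 \<longrightarrow>
      (\<forall>X. periodic_solution \<gamma> h X \<and> vector [h ystar, ystar] \<in> range X \<longrightarrow>
        range X \<inter> {p. p $ 1 = 0} = {vector [0, ystar], vector [0, - exp (- \<gamma> * pi) * ystar]} \<and>
        (h' ystar > 0 \<longrightarrow> stable_limit_cycle \<gamma> h (range X)) \<and>
        (h' ystar < 0 \<longrightarrow> unstable_limit_cycle \<gamma> h (range X))))"
proof -
  interpret two_zone \<gamma> h h'
    by unfold_locales (use assms in auto)
  \<comment> \<open>Changing the sign of \<open>h\<close> and \<open>h'\<close> turns condition (3)
    into condition (2) and vice versa, and makes the derivative at \<open>ystar\<close> positive in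
    the unstable case.\<close>
  interpret R: two_zone \<gamma> "\<lambda>y. - h y" "\<lambda>y. - h' y"
  proof unfold_locales
    fix y :: real
    show "((\<lambda>y. - h y) has_real_derivative - h' y) (at y within {0..})" if "y \<ge> 0"
      using assms(2)[OF that] by (rule DERIV_minus)
    show "- h y * (2 * \<gamma> - (1 + \<gamma>\<^sup>2) * - h' y) < y" if "y > 0"
      using assms(7)[OF that] by (simp add: algebra_simps)
    show "- h y * (2 * \<gamma> + (1 + \<gamma>\<^sup>2) * - h' y) > - y" if "y > 0"
      using assms(6)[OF that] by (simp add: algebra_simps)
  qed (use assms in auto)
  note cp = cp_def[of ystar, symmetric]
  show ?thesis
    unfolding cp
  proof (intro conjI impI allI iffI)
    assume "\<exists>X. periodic_solution \<gamma> h X \<and> cp ystar \<in> range X"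
    then show "h ystar = 0" using periodic_through_curve(1) assms(8) by blast
  next
    assume "h ystar = 0"
    then show "\<exists>X. periodic_solution \<gamma> h X \<and> cp ystar \<in> range X"
      using cycle_solution[OF assms(8)] by (metis rangeI)
  next
    fix X assume h: "h ystar = 0" and "periodic_solution \<gamma> h X \<and> cp ystar \<in> range X"
    then have X: "periodic_solution \<gamma> h X" "cp ystar \<in> range X" by auto
    show "range X \<inter> {p. p $ 1 = 0} = {vector [0, ystar], vector [0, - exp (- \<gamma> * pi) * ystar]}"
      using ring_axis[OF assms(8) h] periodic_through_curve(2)[OF X assms(8)] by simp
    show "stable_limit_cycle \<gamma> h (range X)" if "h' ystar > 0"
      using stable_through_curve[OF X assms(8) that] .
    show "unstable_limit_cycle \<gamma> h (range X)" if neg: "h' ystar < 0"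
    proof (rule unstable_of_mirror_stable)
      show "limit_cycle \<gamma> h (range X)"
        using limit_cycle_through_curve[OF X assms(8)] neg by simp
      have "mirror (cp ystar) = R.cp ystar"
        by (simp add: vec_eq_iff forall_2)
      then have "R.cp ystar \<in> range (\<lambda>t. mirror (X (- t)))"
        using X(2) unfolding range_mirror by (metis imageI)
      from R.stable_through_curve[OF periodic_solution_mirror[OF X(1)] this assms(8)]
      show "stable_limit_cycle \<gamma> (\<lambda>y. - h y) (mirror ` range X)"
        using neg by (simp add: range_mirror)
    qed
  qed
qed

end
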